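(* Let $\sigma$ be a positive integer, $\omega$ a primitive $\sigma$-th root of unity, $G$ a matrix of rank $r$ with column set $E$, and $\mathbb{A}$ of order $q$ with $q\ne2$, in the setting described in the context. Let $\mathbb{A}^\times$ be the set of nonzero elements of $\mathbb{A}$, and for $k=0,\dots,\sigma-1$ let $\mathcal{O}^\times(k,\sigma)$ be the set of pairs $(f,g)$ of functions $f,g:E\to\mathbb{A}^\times$ such that $f-g$ is a flow of $G$ over $\mathbb{A}$ and $|\mathrm{supp}(f-g)|\equiv k\pmod\sigma$. Then $$\sum_{k=0}^{\sigma-1}\omega^k|\mathcal{O}^\times(k,\sigma)| = \omega^{|E|-r}(q-2)^{|E|-r}[(1-\omega)q+2\omega-1]^r\,R\!\left(M(G);\frac{\omega q(q-2)}{(1-\omega)q+2\omega-1},\frac{(1-\omega)q+2\omega-1}{\omega(q-2)}\right).$$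
   Context: Setting (the paper's hypothesis "$G$ is a totally-$\mathbb{P}$ matrix and $\mathbb{A}$ a $\mathbb{P}$-module of order $q$", read as the following cases): either (i) $G$ is the vertex–edge or cycle–edge matrix of a graph with edge set $E$, or a totally unimodular matrix, and $\mathbb{A}$ is an Abelian group of order $q$; or (ii) $G$ is a matrix over $\mathrm{GF}(p^s)$, $\mathbb{A}=\mathrm{GF}(p^s)^d$, $q=p^{sd}$. With $H$ a matrix orthogonally dual to $G$ (same columns, rows of $H$ orthogonal to rows of $G$, ranks summing to $|E|$; integer in case (i)), a flow of $G$ over $\mathbb{A}$ is $h:E\to\mathbb{A}$ with $Hh^T=0$ (equivalently an $\mathbb{A}$-combination of rows of $G$). $\mathrm{supp}(f)=\{e: f(e)\ne0\}$. $M(G)$ is the matroid on $E$ of linear dependence of the columns of $G$, with rank function $\mathrm{rk}$ and rank $r$; $R(M;\lambda,x)=\sum_{B\subseteq E}\lambda^{r-\mathrm{rk}(B)}x^{|B|-\mathrm{rk}(B)}$.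
   Formalization: In case (i) the integer dual H defining flows must itself be a vertex–edge, cycle–edge or totally unimodular matrix; for arbitrary integer H the identity fails, e.g. G=(0), H=(2), A=Z/4, σ=1 gives 5 on the left and 3 on the right. *)

theory Defs
  imports
    Complex_Main
    "HOL-Analysis.Finite_Cartesian_Product"
    "Jordan_Normal_Form.DL_Rank"
    "Jordan_Normal_Form.DL_Submatrix"
    "Graph_Theory.Arc_Walk"
begin

text \<open>
  The column set of a matrix \<open>G\<close> is \<open>{..<dim_col G}\<close>; rows and columns may be absent.
\<close>

definition mat_rank :: "'k::field mat \<Rightarrow> nat" where
  "mat_rank A = vec_space.rank (dim_row A) A"

definition orth_dual :: "'k::field mat \<Rightarrow> 'k mat \<Rightarrow> bool" where
  "orth_dual G H \<longleftrightarrow>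
     dim_col H = dim_col G \<and>
     (\<forall>i<dim_row G. \<forall>j<dim_row H. row G i \<bullet> row H j = 0) \<and>
     mat_rank G + mat_rank H = dim_col G"


section \<open>Totally unimodular matrices and matrices of graphs\<close>

definition totally_unimodular :: "int mat \<Rightarrow> bool" where
  "totally_unimodular A \<longleftrightarrow>
     (\<forall>I J. I \<subseteq> {..<dim_row A} \<longrightarrow> J \<subseteq> {..<dim_col A} \<longrightarrow> card I = card J \<longrightarrow>
        det (submatrix A I J) \<in> {-1, 0, 1})"

text \<open>
  A finite graph (loops and parallel edges allowed) is given by a digraph \<open>D\<close> that records an
  arbitrary reference orientation of its edges. Vertices and edges are numbered; the edges are
  the column indices of the matrices. The column of a loop in the vertex-edge matrix is zero.
\<close>

definition vertex_edge_matrix :: "(nat, nat) pre_digraph \<Rightarrow> int mat \<Rightarrow> bool" where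
  "vertex_edge_matrix D A \<longleftrightarrow>
     fin_digraph D \<and> verts D = {..<dim_row A} \<and> arcs D = {..<dim_col A} \<and>
     (\<forall>v<dim_row A. \<forall>e<dim_col A.
        A $$ (v, e) = (if head D e = v then 1 else 0) - (if tail D e = v then 1 else 0))"

text \<open>
  Undirected walks are directed walks in the digraph below, in which \<open>(e, True)\<close> traverses \<open>e\<close>
  along its reference orientation and \<open>(e, False)\<close> against it.
\<close>

definition both_ways :: "('v, 'e) pre_digraph \<Rightarrow> ('v, 'e \<times> bool) pre_digraph" where
  "both_ways D =
     \<lparr> verts = verts D, arcs = arcs D \<times> UNIV,
       tail = (\<lambda>(e, b). if b then tail D e else head D e),
       head = (\<lambda>(e, b). if b then head D e else tail D e) \<rparr>"

text \<open>
  The distinctness condition only excludes going back and forth along a single edge; a loop, and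
  a pair of parallel edges, do form cycles.
\<close>

definition graph_cycle :: "('v, 'e) pre_digraph \<Rightarrow> ('e \<times> bool) list \<Rightarrow> bool" where
  "graph_cycle D p \<longleftrightarrow> pre_digraph.cycle (both_ways D) p \<and> distinct (map fst p)"

definition cycle_entry :: "('e \<times> bool) list \<Rightarrow> 'e \<Rightarrow> int" where
  "cycle_entry p e = (if (e, True) \<in> set p then 1 else if (e, False) \<in> set p then -1 else 0)"

text \<open>
  Every row is the signed incidence vector of a cycle and every cycle provides a row, in one of
  its two directions of traversal. Repeated rows are tolerated.
\<close>

definition cycle_edge_matrix :: "(nat, nat) pre_digraph \<Rightarrow> int mat \<Rightarrow> bool" where
  "cycle_edge_matrix D A \<longleftrightarrow>
     fin_digraph D \<and> arcs D = {..<dim_col A} \<and>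
     (\<forall>i<dim_row A. \<exists>p. graph_cycle D p \<and> (\<forall>e<dim_col A. A $$ (i, e) = cycle_entry p e)) \<and>
     (\<forall>p. graph_cycle D p \<longrightarrow>
        (\<exists>i<dim_row A. (\<forall>e<dim_col A. A $$ (i, e) = cycle_entry p e) \<or>
                       (\<forall>e<dim_col A. A $$ (i, e) = - cycle_entry p e)))"

definition regular_matrix :: "int mat \<Rightarrow> bool" where
  "regular_matrix A \<longleftrightarrow>
     (\<exists>D. vertex_edge_matrix D A) \<or> (\<exists>D. cycle_edge_matrix D A) \<or> totally_unimodular A"

text \<open>
  For integer matrices rank, orthogonal duality and linear dependence are taken over \<open>\<rat>\<close>. The
  dual \<open>H\<close> is again required to be of one of the three kinds: for an arbitrary integer matrix
  \<open>H\<close> the solutions of \<open>H h\<^sup>T = 0\<close> over a finite group need not be the combinations of rows of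
  \<open>G\<close> (take \<open>G = (0)\<close>, \<open>H = (2)\<close> and a group of order 4).
\<close>

abbreviation rat_mat :: "int mat \<Rightarrow> rat mat" where
  "rat_mat A \<equiv> map_mat rat_of_int A"

definition regular_dual :: "int mat \<Rightarrow> int mat \<Rightarrow> bool" where
  "regular_dual G H \<longleftrightarrow> regular_matrix H \<and> orth_dual (rat_mat G) (rat_mat H)"


section \<open>Flows\<close>

definition int_scale :: "int \<Rightarrow> 'a::ab_group_add \<Rightarrow> 'a" where
  "int_scale k x = (if 0 \<le> k then (\<Sum>i<nat k. x) else - (\<Sum>i<nat (- k). x))"

text \<open>
  \<open>act\<close> denotes the action of the matrix entries on \<open>\<A>\<close>, and \<open>H\<close> is a dual of the matrix whose
  flows are described.
\<close>

definition is_flow :: "('r \<Rightarrow> 'a \<Rightarrow> 'a::ab_group_add) \<Rightarrow> 'r mat \<Rightarrow> (nat \<Rightarrow> 'a) \<Rightarrow> bool" where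
  "is_flow act H h \<longleftrightarrow>
     (\<forall>i<dim_row H. (\<Sum>e<dim_col H. act (H $$ (i, e)) (h e)) = 0)"

definition supp :: "nat \<Rightarrow> (nat \<Rightarrow> 'a::zero) \<Rightarrow> nat set" where
  "supp n h = {e \<in> {..<n}. h e \<noteq> 0}"

definition nowhere_zero_pairs ::
  "('r \<Rightarrow> 'a \<Rightarrow> 'a::ab_group_add) \<Rightarrow> 'r mat \<Rightarrow> nat \<Rightarrow> nat \<Rightarrow> ((nat \<Rightarrow> 'a) \<times> (nat \<Rightarrow> 'a)) set" where
  "nowhere_zero_pairs act H k \<sigma> =
     {(f, g). f \<in> {..<dim_col H} \<rightarrow>\<^sub>E UNIV - {0} \<and> g \<in> {..<dim_col H} \<rightarrow>\<^sub>E UNIV - {0} \<and>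
        is_flow act H (\<lambda>e. f e - g e) \<and>
        card (supp (dim_col H) (\<lambda>e. f e - g e)) mod \<sigma> = k mod \<sigma>}"


section \<open>Matroids\<close>

text \<open>A matroid is represented by its ground set and the family of its independent sets.\<close>

type_synonym 'e matroid = "'e set \<times> 'e set set"

definition matroid_rank :: "'e matroid \<Rightarrow> 'e set \<Rightarrow> nat" where
  "matroid_rank M B = Max (card ` {I \<in> snd M. I \<subseteq> B})"

definition column_matroid :: "'k::field mat \<Rightarrow> nat matroid" where
  "column_matroid G =
     ({..<dim_col G},
      {I. I \<subseteq> {..<dim_col G} \<and> inj_on (col G) I \<and>
          \<not> module.lin_dep class_ring (module_vec TYPE('k) (dim_row G)) (col G ` I)})"

definition rank_poly :: "'e matroid \<Rightarrow> complex \<Rightarrow> complex \<Rightarrow> complex" where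
  "rank_poly M l x =
     (\<Sum>B\<in>Pow (fst M). l ^ (matroid_rank M (fst M) - matroid_rank M B) *
                       x ^ (card B - matroid_rank M B))"


definition primitive_root_of_unity :: "nat \<Rightarrow> complex \<Rightarrow> bool" where
  "primitive_root_of_unity \<sigma> \<omega> \<longleftrightarrow> \<omega> ^ \<sigma> = 1 \<and> (\<forall>k. 0 < k \<and> k < \<sigma> \<longrightarrow> \<omega> ^ k \<noteq> 1)"

end

theory Submission
  imports Defs
begin

text \<open>
  Grouping the pairs \<open>(f, g)\<close> by the flow \<open>h = f - g\<close>, the left-hand side becomes the sum over all
  flows \<open>h\<close> of \<open>\<Prod>\<^sub>e c (h e)\<close> with \<open>c 0 = q - 1\<close> and \<open>c x = \<omega> (q - 2)\<close> for \<open>x \<noteq> 0\<close>. Writing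
  \<open>q - 1 = d + \<omega> (q - 2)\<close> with \<open>d = (1 - \<omega>) q + 2 \<omega> - 1\<close> and expanding the product, the weight of a
  set \<open>B\<close> of columns is multiplied by the number of flows vanishing on \<open>B\<close>, which is
  \<open>q ^ (r - rk B)\<close>.

  For the count, suppose that every independent set \<open>J\<close> of columns of \<open>H\<close> admits row combinations
  dual to \<open>J\<close>, with coefficients in the ring of entries. Then a basis \<open>J\<close> of \<open>F\<close> expresses all columns
  in \<open>F\<close> over that ring, and a solution of \<open>H h = 0\<close> supported on \<open>F\<close> is freely determined by its
  values on \<open>F - J\<close>. Over a field this is plain linear algebra; for totally unimodular matrices the
  dual combinations come from an adjugate, for vertex-edge matrices from the components of a forest
  minus an edge, and for cycle-edge matrices from a cycle that meets \<open>J\<close> in a single edge. Matroid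
  duality turns the exponent \<open>|F| - rk\<^sub>H F\<close> with \<open>F = E - B\<close> into \<open>r - rk\<^sub>G B\<close>.
\<close>

section \<open>Column matroids\<close>

text \<open>Independence of a family indexed by columns, not of a set of vectors: a repeated column
  makes the family dependent without a separate injectivity condition.\<close>

definition cols_indep :: "'k::field mat \<Rightarrow> nat set \<Rightarrow> bool" where
  "cols_indep M I \<longleftrightarrow> I \<subseteq> {..<dim_col M} \<and>
     (\<forall>c. (\<forall>i<dim_row M. (\<Sum>e\<in>I. M $$ (i, e) * c e) = 0) \<longrightarrow> (\<forall>e\<in>I. c e = 0))"

lemma cols_indepD:
  assumes "cols_indep M I" "\<And>i. i < dim_row M \<Longrightarrow> (\<Sum>e\<in>I. M $$ (i, e) * c e) = 0" "e \<in> I"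
  shows "c e = 0"
  using assms unfolding cols_indep_def by blast

lemma cols_indep_subset: "cols_indep M I \<Longrightarrow> I \<subseteq> {..<dim_col M}"
  unfolding cols_indep_def by blast

lemma cols_indep_finite: "cols_indep M I \<Longrightarrow> finite I"
  using cols_indep_subset finite_subset by blast

lemma cols_indep_mono:
  assumes "cols_indep M I" "J \<subseteq> I"
  shows "cols_indep M J"
  unfolding cols_indep_def
proof (intro conjI allI impI ballI)
  show "J \<subseteq> {..<dim_col M}" using cols_indep_subset assms by blast
next
  fix c e assume c: "\<forall>i<dim_row M. (\<Sum>e\<in>J. M $$ (i, e) * c e) = 0" and e: "e \<in> J"
  have "(\<Sum>e\<in>I. M $$ (i, e) * (if e \<in> J then c e else 0)) = 0" if "i < dim_row M" for i
  proof -
    have "(\<Sum>e\<in>I. M $$ (i, e) * (if e \<in> J then c e else 0)) = (\<Sum>e\<in>J. M $$ (i, e) * c e)"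
      using assms cols_indep_finite[OF assms(1)] by (intro sum.mono_neutral_cong_right) auto
    then show ?thesis using c that by simp
  qed
  from cols_indepD[OF assms(1) this, of e] show "c e = 0" using e assms(2) by auto
qed

text \<open>Gaussian elimination: one equation is solved for one unknown and substituted into the
  others, which lowers both numbers by one.\<close>

lemma underdetermined_system:
  fixes a :: "'x \<Rightarrow> 'y \<Rightarrow> 'k::field"
  assumes "finite X" "finite Y" "card X < card Y"
  shows "\<exists>c. (\<exists>y\<in>Y. c y \<noteq> 0) \<and> (\<forall>x\<in>X. (\<Sum>y\<in>Y. a x y * c y) = 0)"
  using assms
proof (induction X arbitrary: Y a rule: finite_induct)
  case empty
  then obtain y where "y \<in> Y" by fastforce
  then show ?case by (intro exI[of _ "\<lambda>_. 1"]) auto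
next
  case (insert x X)
  show ?case
  proof (cases "\<forall>y\<in>Y. a x y = 0")
    case True
    have "card X < card Y" using insert by simp
    then obtain c where "(\<exists>y\<in>Y. c y \<noteq> 0) \<and> (\<forall>x\<in>X. (\<Sum>y\<in>Y. a x y * c y) = 0)"
      using insert.IH[OF insert.prems(1)] by blast
    then show ?thesis using True by (intro exI[of _ c]) simp
  next
    case False
    then obtain z where z: "z \<in> Y" "a x z \<noteq> 0" by blast
    let ?Y = "Y - {z}"
    \<comment> \<open>The coefficients left after eliminating the unknown \<open>z\<close> by means
      of equation \<open>x\<close>.\<close>
    define b where "b x' y = a x' y - a x' z * a x y / a x z" for x' y
    have "card X < card ?Y" using insert z by simp
    then obtain c where c: "\<exists>y\<in>?Y. c y \<noteq> 0" "\<forall>x\<in>X. (\<Sum>y\<in>?Y. b x y * c y) = 0"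
      using insert.IH[of ?Y b] insert.prems(1) by blast
    define s where "s = (\<Sum>y\<in>?Y. a x y * c y)"
    \<comment> \<open>Back substitution: equation \<open>x\<close> forces this value at
      \<open>z\<close>.\<close>
    define d where "d = c(z := - s / a x z)"
    have split: "(\<Sum>y\<in>Y. a x' y * d y) = a x' z * (- s / a x z) + (\<Sum>y\<in>?Y. a x' y * c y)" for x'
      using insert.prems(1) z by (simp add: sum.remove[of Y z] d_def)
    have "(\<Sum>y\<in>Y. a x' y * d y) = (\<Sum>y\<in>?Y. b x' y * c y)" for x'
      unfolding split s_def b_def left_diff_distrib sum_subtractf
      by (simp add: sum_distrib_left sum_divide_distrib mult.assoc)
    moreover have "(\<Sum>y\<in>Y. a x y * d y) = 0"
      unfolding split using z by (simp add: s_def)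
    moreover have "\<exists>y\<in>Y. d y \<noteq> 0" using c(1) by (auto simp: d_def)
    ultimately show ?thesis using c(2) by (intro exI[of _ d]) auto
  qed
qed

text \<open>A nontrivial relation on \<open>insert e I\<close> must involve \<open>e\<close>, since
  \<open>I\<close> is independent; dividing by its coefficient isolates the column.\<close>

lemma dependent_insert_column:
  assumes "cols_indep M I" "e < dim_col M" "e \<notin> I" "\<not> cols_indep M (insert e I)"
  shows "\<exists>x. \<forall>i<dim_row M. M $$ (i, e) = (\<Sum>f\<in>I. M $$ (i, f) * x f)"
proof -
  have fin: "finite I" using cols_indep_finite[OF assms(1)] .
  obtain c f where c: "\<forall>i<dim_row M. (\<Sum>e\<in>insert e I. M $$ (i, e) * c e) = 0"
    and f: "f \<in> insert e I" "c f \<noteq> 0"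
    using assms(2,4) cols_indep_subset[OF assms(1)] unfolding cols_indep_def by auto
  have eq: "M $$ (i, e) * c e + (\<Sum>e\<in>I. M $$ (i, e) * c e) = 0" if "i < dim_row M" for i
    using c that fin assms(3) by simp
  have "c e \<noteq> 0"
  proof
    assume "c e = 0"
    then have "(\<Sum>e\<in>I. M $$ (i, e) * c e) = 0" if "i < dim_row M" for i using eq[OF that] by simp
    from cols_indepD[OF assms(1) this] f \<open>c e = 0\<close> show False by auto
  qed
  have "M $$ (i, e) = (\<Sum>f\<in>I. M $$ (i, f) * (- c f / c e))" if "i < dim_row M" for i
  proof -
    have "(\<Sum>f\<in>I. M $$ (i, f) * (- c f / c e)) = - (\<Sum>f\<in>I. M $$ (i, f) * c f) / c e"
      by (simp add: sum_divide_distrib sum_negf)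
    also have "- (\<Sum>f\<in>I. M $$ (i, f) * c f) = M $$ (i, e) * c e"
      using eq[OF that] by (simp add: add_eq_0_iff)
    also have "\<dots> / c e = M $$ (i, e)" using \<open>c e \<noteq> 0\<close> by simp
    finally show ?thesis by simp
  qed
  then show ?thesis by (intro exI[of _ "\<lambda>f. - c f / c e"]) simp
qed

text \<open>If no column of \<open>J\<close> extended \<open>I\<close>, all of them would be
  combinations of fewer columns; their coordinates form an underdetermined system, and a nonzero
  solution is a relation on \<open>J\<close>.\<close>

lemma cols_indep_exchange:
  assumes "cols_indep M I" "cols_indep M J" "card I < card J"
  shows "\<exists>e\<in>J - I. cols_indep M (insert e I)"
proof (rule ccontr)
  assume neg: "\<not> ?thesis"
  have fin: "finite I" "finite J" using assms cols_indep_finite by blast+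
  have "\<exists>x. \<forall>i<dim_row M. M $$ (i, e) = (\<Sum>f\<in>I. M $$ (i, f) * x f)" if "e \<in> J" for e
  proof (cases "e \<in> I")
    case True
    then show ?thesis using fin
      by (intro exI[of _ "\<lambda>f. if f = e then 1 else 0"]) (simp add: if_distrib[of "(*) _"] cong: if_cong)
  next
    case False
    then show ?thesis
      using dependent_insert_column[OF assms(1)] neg that cols_indep_subset[OF assms(2)] by blast
  qed
  then obtain x where x: "\<And>e i. e \<in> J \<Longrightarrow> i < dim_row M \<Longrightarrow> M $$ (i, e) = (\<Sum>f\<in>I. M $$ (i, f) * x e f)"
    by metis
  obtain c where c: "\<exists>e\<in>J. c e \<noteq> 0" "\<forall>f\<in>I. (\<Sum>e\<in>J. x e f * c e) = 0"
    using underdetermined_system[OF fin assms(3), of "\<lambda>f e. x e f"] by blast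
  have "(\<Sum>e\<in>J. M $$ (i, e) * c e) = 0" if "i < dim_row M" for i
  proof -
    have "(\<Sum>e\<in>J. M $$ (i, e) * c e) = (\<Sum>e\<in>J. \<Sum>f\<in>I. M $$ (i, f) * (x e f * c e))"
      using x that by (simp add: sum_distrib_right mult.assoc)
    also have "\<dots> = (\<Sum>f\<in>I. M $$ (i, f) * (\<Sum>e\<in>J. x e f * c e))"
      by (subst sum.swap) (simp add: sum_distrib_left)
    also have "\<dots> = 0" using c(2) by simp
    finally show ?thesis .
  qed
  from cols_indepD[OF assms(2) this] c(1) show False by blast
qed

lemma column_matroid_indep_iff: "I \<in> snd (column_matroid M) \<longleftrightarrow> cols_indep (M :: 'k::field mat) I"
proof -
  interpret V: vec_space "TYPE('k)" "dim_row M" .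
  have carr: "col M ` J \<subseteq> carrier_vec (dim_row M)" for J by auto
  have coli: "col M e $ i = M $$ (i, e)" if "i < dim_row M" "e < dim_col M" for i e
    using that by simp
  show ?thesis
  proof
    assume "I \<in> snd (column_matroid M)"
    then have I: "I \<subseteq> {..<dim_col M}" and inj: "inj_on (col M) I" and li: "\<not> V.lin_dep (col M ` I)"
      by (auto simp: column_matroid_def)
    have fin: "finite I" using I finite_subset by blast
    show "cols_indep M I"
      unfolding cols_indep_def
    proof (intro conjI allI impI ballI I)
      fix c e assume c: "\<forall>i<dim_row M. (\<Sum>e\<in>I. M $$ (i, e) * c e) = 0" and e: "e \<in> I"
      define a where "a v = c (the_inv_into I (col M) v)" for v
      have ac: "a (col M e) = c e" if "e \<in> I" for e
        using that inj by (simp add: a_def the_inv_into_f_f)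
      have "V.lincomb a (col M ` I) = 0\<^sub>v (dim_row M)"
      proof (rule eq_vecI)
        show "dim_vec (V.lincomb a (col M ` I)) = dim_vec (0\<^sub>v (dim_row M))"
          using V.lincomb_dim[OF _ carr] fin by simp
        fix i assume "i < dim_vec (0\<^sub>v (dim_row M) :: 'k vec)"
        then have i: "i < dim_row M" by simp
        have "V.lincomb a (col M ` I) $ i = (\<Sum>e\<in>I. c e * M $$ (i, e))"
          unfolding V.lincomb_index[OF i carr] sum.reindex[OF inj]
          using I i by (intro sum.cong) (auto simp: ac)
        then show "V.lincomb a (col M ` I) $ i = 0\<^sub>v (dim_row M) $ i"
          using c i by (simp add: mult.commute)
      qed
      then show "c e = 0"
        using V.lin_dep_crit[where A = "col M ` I" and S = "col M ` I" and a = a and v = "col M e"] li fin e carr ac by auto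
    qed
  next
    assume ind: "cols_indep M I"
    have I: "I \<subseteq> {..<dim_col M}" using cols_indep_subset[OF ind] .
    have fin: "finite I" using cols_indep_finite[OF ind] .
    have inj: "inj_on (col M) I"
    proof (rule inj_onI, rule ccontr)
      fix e f assume ef: "e \<in> I" "f \<in> I" "col M e = col M f" "e \<noteq> f"
      have "M $$ (i, e) = M $$ (i, f)" if "i < dim_row M" for i
        by (metis coli ef(1-3) I lessThan_iff subsetD that)
      \<comment> \<open>Equal columns give the relation with coefficients 1 at \<open>e\<close> and
        -1 at \<open>f\<close>.\<close>
      then have "(\<Sum>g\<in>I. M $$ (i, g) * ((if g = e then 1 else 0) - (if g = f then 1 else 0))) = 0" if "i < dim_row M" for i
        using that fin ef by (simp add: right_diff_distrib sum_subtractf if_distrib[of "(*) _"] cong: if_cong)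
      from cols_indepD[OF ind this ef(1)] ef(4) show False by simp
    qed
    have "\<not> V.lin_dep (col M ` I)"
    proof
      assume "V.lin_dep (col M ` I)"
      then obtain a v where a: "V.lincomb a (col M ` I) = 0\<^sub>v (dim_row M)" "v \<in> col M ` I" "a v \<noteq> 0"
        using V.finite_lin_dep[of "col M ` I"] fin carr by (auto simp: module_vec_simps)
      have "(\<Sum>e\<in>I. M $$ (i, e) * a (col M e)) = 0" if i: "i < dim_row M" for i
      proof -
        have "V.lincomb a (col M ` I) $ i = (\<Sum>e\<in>I. a (col M e) * M $$ (i, e))"
          unfolding V.lincomb_index[OF i carr] sum.reindex[OF inj]
          using I i by (intro sum.cong) auto
        then show ?thesis using a(1) i by (simp add: mult.commute)
      qed
      from cols_indepD[OF ind this] a show False by auto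
    qed
    then show "I \<in> snd (column_matroid M)"
      using I inj by (auto simp: column_matroid_def)
  qed
qed

section \<open>Ranks of column sets\<close>

abbreviation col_rank :: "'k::field mat \<Rightarrow> nat set \<Rightarrow> nat" where
  "col_rank M \<equiv> matroid_rank (column_matroid M)"

lemma cols_indep_empty: "cols_indep M {}"
  by (simp add: cols_indep_def)

lemma finite_cols_indep: "finite {I. cols_indep M I \<and> P I}"
  by (rule finite_subset[of _ "Pow {..<dim_col M}"]) (auto dest: cols_indep_subset)

lemma col_rank_eq_Max: "col_rank M B = Max (card ` {I. cols_indep M I \<and> I \<subseteq> B})"
  by (simp add: matroid_rank_def column_matroid_indep_iff)

lemma card_le_col_rank: "cols_indep M I \<Longrightarrow> I \<subseteq> B \<Longrightarrow> card I \<le> col_rank M B"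
  unfolding col_rank_eq_Max by (intro Max_ge finite_imageI finite_cols_indep) auto

lemma col_rank_attained: "\<exists>I. cols_indep M I \<and> I \<subseteq> B \<and> card I = col_rank M B"
proof -
  have "col_rank M B \<in> card ` {I. cols_indep M I \<and> I \<subseteq> B}"
    unfolding col_rank_eq_Max using cols_indep_empty[of M]
    by (intro Max_in finite_imageI finite_cols_indep) auto
  then show ?thesis by auto
qed

text \<open>A largest independent set between \<open>J\<close> and \<open>B\<close> cannot be
  smaller than a basis of \<open>B\<close>, because an exchange would enlarge it within the same
  bounds.\<close>

lemma extend_to_basis:
  assumes "cols_indep M J" "J \<subseteq> B"
  shows "\<exists>I. cols_indep M I \<and> J \<subseteq> I \<and> I \<subseteq> B \<and> card I = col_rank M B"
proof -
  let ?S = "{I. cols_indep M I \<and> J \<subseteq> I \<and> I \<subseteq> B}"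
  have fin: "finite (card ` ?S)" by (intro finite_imageI finite_cols_indep)
  have "Max (card ` ?S) \<in> card ` ?S" using fin assms by (intro Max_in) auto
  then obtain I where I: "I \<in> ?S" "card I = Max (card ` ?S)" by auto
  obtain I' where I': "cols_indep M I'" "I' \<subseteq> B" "card I' = col_rank M B"
    using col_rank_attained by blast
  have "\<not> card I < card I'"
  proof
    assume "card I < card I'"
    then obtain e where e: "e \<in> I' - I" "cols_indep M (insert e I)"
      using cols_indep_exchange[OF _ I'(1)] I(1) by blast
    then have "insert e I \<in> ?S" using I I' by auto
    then have "card (insert e I) \<le> card I" using fin I(2) Max_ge by fastforce
    then show False using e I(1) cols_indep_finite[of M I] by auto
  qed
  moreover have "card I \<le> col_rank M B" using I(1) card_le_col_rank by blast
  ultimately show ?thesis using I I' by (intro exI[of _ I]) auto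
qed

text \<open>The rank of a matrix is the size of any maximal independent set of its column vectors,
  and the image of a largest independent index set is one.\<close>

lemma mat_rank_eq_col_rank: "mat_rank M = col_rank (M :: 'k::field mat) {..<dim_col M}"
proof -
  interpret V: vec_space "TYPE('k)" "dim_row M" .
  have ind: "cols_indep M I \<longleftrightarrow> I \<subseteq> {..<dim_col M} \<and> inj_on (col M) I \<and> \<not> V.lin_dep (col M ` I)" for I
    unfolding column_matroid_indep_iff[symmetric] by (auto simp: column_matroid_def)
  obtain I where I: "cols_indep M I" "card I = col_rank M {..<dim_col M}"
    using col_rank_attained by blast
  have setc: "set (cols M) = col M ` {..<dim_col M}" by (auto simp: cols_def)
  have "maximal (col M ` I) (\<lambda>T. T \<subseteq> set (cols M) \<and> \<not> V.lin_dep T)"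
    unfolding maximal_def
  proof (intro conjI allI impI)
    show "col M ` I \<subseteq> set (cols M)" "\<not> V.lin_dep (col M ` I)" using I(1) by (auto simp: ind setc)
    fix T assume T: "col M ` I \<subseteq> T \<and> T \<subseteq> set (cols M) \<and> \<not> V.lin_dep T"
    then obtain J where J: "J \<subseteq> {..<dim_col M}" "inj_on (col M) J" "T = col M ` J"
      unfolding setc subset_image_inj by blast
    have indJ: "cols_indep M J" using J T by (simp add: ind)
    have "card T = card J" using J by (simp add: card_image)
    also have "\<dots> \<le> card I" using card_le_col_rank[OF indJ] J I by simp
    also have "\<dots> = card (col M ` I)" using I(1) by (simp add: ind card_image)
    finally have "T = col M ` I" using T J indJ cols_indep_finite by (metis card_seteq finite_imageI)
    then show "T = col M ` I" .
  qed
  then have "V.rank M = card (col M ` I)" by (intro V.rank_card_indpt) auto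
  then show ?thesis using I by (simp add: mat_rank_def ind card_image)
qed

section \<open>Dual systems of functionals\<close>

text \<open>
  \<open>y j i\<close> is the coefficient of row \<open>i\<close> in the row combination that is \<open>1\<close> at column \<open>j\<close> and \<open>0\<close> at
  the other columns in \<open>J\<close>.
\<close>

definition dual_system :: "'r::comm_ring_1 mat \<Rightarrow> nat set \<Rightarrow> (nat \<Rightarrow> nat \<Rightarrow> 'r) \<Rightarrow> bool" where
  "dual_system M J y \<longleftrightarrow>
     (\<forall>j\<in>J. \<forall>k\<in>J. (\<Sum>i<dim_row M. y j i * M $$ (i, k)) = (if k = j then 1 else 0))"

lemma dual_system_coeff:
  assumes "dual_system M J y" "finite J" "j \<in> J"
  shows "(\<Sum>i<dim_row M. y j i * (\<Sum>k\<in>J. M $$ (i, k) * c k)) = c j"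
proof -
  have "(\<Sum>i<dim_row M. y j i * (\<Sum>k\<in>J. M $$ (i, k) * c k)) =
      (\<Sum>k\<in>J. (\<Sum>i<dim_row M. y j i * M $$ (i, k)) * c k)"
    by (simp add: sum_distrib_left sum_distrib_right mult.assoc) (rule sum.swap)
  also have "\<dots> = (\<Sum>k\<in>J. if k = j then c k else 0)"
    using assms by (intro sum.cong) (auto simp: dual_system_def)
  finally show ?thesis using assms by simp
qed

text \<open>Each new column costs at most one new row: a row that separates it from the span of the
  earlier columns is corrected to vanish on these and then used to clear the new column from the
  earlier functionals. The bound on the rows later yields a square submatrix.\<close>

lemma dual_system_exists_support_le:
  fixes M :: "'k::field mat"
  assumes "finite J" "cols_indep M J"
  shows "\<exists>I y. I \<subseteq> {..<dim_row M} \<and> card I \<le> card J \<and> dual_system M J y \<and>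
           (\<forall>j\<in>J. \<forall>i. i \<notin> I \<longrightarrow> y j i = 0)"
  using assms
proof (induction J rule: finite_induct)
  case empty
  then show ?case by (intro exI[of _ "{}"]) (auto simp: dual_system_def)
next
  case (insert j J)
  then obtain I y where I: "I \<subseteq> {..<dim_row M}" "card I \<le> card J"
    and y: "dual_system M J y" and supp: "\<forall>j\<in>J. \<forall>i. i \<notin> I \<longrightarrow> y j i = 0"
    using cols_indep_mono[OF insert.prems, of J] by blast
  define D where "D k m = (\<Sum>l<dim_row M. y k l * M $$ (l, m))" for k m
  have D: "D k m = (if m = k then 1 else 0)" if "k \<in> J" "m \<in> J" for k m
    using y that by (auto simp: dual_system_def D_def)
  \<comment> \<open>\<open>D k j\<close> is the only possible coordinate of column \<open>j\<close>
    along column \<open>k\<close>; if every row agreed with this expansion, column \<open>j\<close>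
    would depend on \<open>J\<close>.\<close>
  have "\<exists>i<dim_row M. M $$ (i, j) \<noteq> (\<Sum>k\<in>J. M $$ (i, k) * D k j)"
  proof (rule ccontr)
    assume "\<not> ?thesis"
    then have "(\<Sum>k\<in>insert j J. M $$ (i, k) * (if k = j then 1 else - D k j)) = 0"
      if "i < dim_row M" for i
      using that insert.hyps
      by (auto simp: sum_negf if_distrib[of "(*) _"] sum.If_cases cong: if_cong sum.cong intro!: sum.cong)
    from cols_indepD[OF insert.prems this, of j] show False by simp
  qed
  then obtain i where i: "i < dim_row M" "M $$ (i, j) \<noteq> (\<Sum>k\<in>J. M $$ (i, k) * D k j)" by blast
  define t where "t = M $$ (i, j) - (\<Sum>k\<in>J. M $$ (i, k) * D k j)"
  have t: "t \<noteq> 0" using i by (simp add: t_def)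
  \<comment> \<open>Row \<open>i\<close> minus its part on the earlier columns, divided by the
    defect \<open>t\<close> so as to take the value 1 at \<open>j\<close>.\<close>
  define z where "z l = ((if l = i then 1 else 0) - (\<Sum>k\<in>J. M $$ (i, k) * y k l)) / t" for l
  \<comment> \<open>Subtracting a multiple of \<open>z\<close> makes an earlier functional vanish at
    \<open>j\<close> and keeps its values on \<open>J\<close>.\<close>
  define y' where "y' k l = (if k = j then z l else y k l - D k j * z l)" for k l
  have z: "(\<Sum>l<dim_row M. z l * M $$ (l, m)) = (M $$ (i, m) - (\<Sum>k\<in>J. M $$ (i, k) * D k m)) / t" for m
  proof -
    have "(\<Sum>l<dim_row M. z l * M $$ (l, m)) =
       ((\<Sum>l<dim_row M. (if l = i then 1 else 0) * M $$ (l, m)) -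
        (\<Sum>l<dim_row M. \<Sum>k\<in>J. M $$ (i, k) * (y k l * M $$ (l, m)))) / t"
      by (simp add: z_def left_diff_distrib sum_subtractf sum_divide_distrib sum_distrib_right
          diff_divide_distrib mult.assoc)
    also have "(\<Sum>l<dim_row M. (if l = i then 1 else 0) * M $$ (l, m)) = M $$ (i, m)"
      using i(1) by (simp add: if_distrib[of "\<lambda>x. x * _"] cong: if_cong)
    also have "(\<Sum>l<dim_row M. \<Sum>k\<in>J. M $$ (i, k) * (y k l * M $$ (l, m))) =
        (\<Sum>k\<in>J. M $$ (i, k) * D k m)"
      by (subst sum.swap) (simp add: D_def sum_distrib_left)
    finally show ?thesis .
  qed
  have zJ: "(\<Sum>l<dim_row M. z l * M $$ (l, m)) = 0" if "m \<in> J" for m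
  proof -
    have "(\<Sum>k\<in>J. M $$ (i, k) * D k m) = (\<Sum>k\<in>J. if k = m then M $$ (i, k) else 0)"
      using that by (intro sum.cong) (auto simp: D)
    then show ?thesis using that insert.hyps by (simp add: z)
  qed
  have zj: "(\<Sum>l<dim_row M. z l * M $$ (l, j)) = 1"
    unfolding z using t by (simp add: t_def)
  have y'J: "(\<Sum>l<dim_row M. y' k l * M $$ (l, m)) = D k m - D k j * (\<Sum>l<dim_row M. z l * M $$ (l, m))"
    if "k \<noteq> j" for k m
    using that by (simp add: y'_def left_diff_distrib sum_subtractf D_def sum_distrib_left mult.assoc)
  have y'j: "(\<Sum>l<dim_row M. y' j l * M $$ (l, m)) = (\<Sum>l<dim_row M. z l * M $$ (l, m))" for m
    by (simp add: y'_def)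
  have "dual_system M (insert j J) y'"
    unfolding dual_system_def
  proof (intro ballI)
    fix k m assume k: "k \<in> insert j J" and m: "m \<in> insert j J"
    show "(\<Sum>i<dim_row M. y' k i * M $$ (i, m)) = (if m = k then 1 else 0)"
    proof (cases "k = j")
      case True
      then show ?thesis using y'j zJ zj m insert.hyps by auto
    next
      case False
      then show ?thesis using y'J[OF False] zJ zj m k insert.hyps D by auto
    qed
  qed
  moreover have "y' k l = 0" if "k \<in> insert j J" "l \<notin> insert i I" for k l
  proof -
    have "z l = 0" using that(2) supp by (simp add: z_def)
    then show ?thesis using that supp by (auto simp: y'_def)
  qed
  moreover have "card (insert i I) \<le> card (insert j J)"
    using I insert.hyps finite_subset[OF I(1)] by (auto simp: card_insert_if)
  ultimately show ?case using I(1) i(1) by (intro exI[of _ "insert i I"] exI[of _ y']) auto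
qed

text \<open>With fewer rows than columns, a nonzero combination of the columns in \<open>J\<close>
  would vanish on the rows in \<open>I\<close>; but functionals supported on \<open>I\<close> read
  off its coefficients, which would then be zero.\<close>

lemma dual_system_exists:
  fixes M :: "'k::field mat"
  assumes J: "cols_indep M J"
  obtains I y where "I \<subseteq> {..<dim_row M}" "card I = card J" "dual_system M J y"
    "\<And>j i. j \<in> J \<Longrightarrow> i \<notin> I \<Longrightarrow> y j i = 0"
proof -
  have fin: "finite J" using J by (rule cols_indep_finite)
  obtain I y where I: "I \<subseteq> {..<dim_row M}" "card I \<le> card J" "dual_system M J y"
    and supp: "\<forall>j\<in>J. \<forall>i. i \<notin> I \<longrightarrow> y j i = 0"
    using dual_system_exists_support_le[OF fin J] by blast
  have "\<not> card I < card J"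
  proof
    assume "card I < card J"
    then obtain c where c: "\<exists>j\<in>J. c j \<noteq> 0" "\<forall>i\<in>I. (\<Sum>j\<in>J. M $$ (i, j) * c j) = 0"
      using underdetermined_system[of I J "\<lambda>i j. M $$ (i, j)"] finite_subset[OF I(1)] fin by auto
    have "c j = 0" if "j \<in> J" for j
    proof -
      have "y j i * (\<Sum>k\<in>J. M $$ (i, k) * c k) = 0" for i
        using c(2) supp that by (cases "i \<in> I") auto
      then show ?thesis using dual_system_coeff[OF I(3) fin that, of c] by simp
    qed
    then show False using c(1) by blast
  qed
  then show ?thesis using that I supp by (metis le_neq_implies_less)
qed

section \<open>Orthogonal duality\<close>

lemma orth_dual_sym: "orth_dual G H \<Longrightarrow> orth_dual H G"
  unfolding orth_dual_def
  by (auto simp: add.commute) (metis comm_scalar_prod row_carrier)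

text \<open>A relation among the complementary columns of \<open>H\<close>, together with the row
  combinations of \<open>G\<close> dual to \<open>I\<close>, would give one more independent vector
  in the kernel of \<open>H\<close> than its dimension allows. The contradiction comes from a
  nontrivial combination \<open>u\<close> that vanishes off a basis of \<open>H\<close> and is
  therefore zero.\<close>

lemma orth_dual_basis_complement:
  fixes G :: "'k::field mat"
  assumes GH: "orth_dual G H" and I: "cols_indep G I" "card I = mat_rank G"
  shows "cols_indep H ({..<dim_col G} - I)"
  unfolding cols_indep_def
proof (intro conjI allI impI ballI)
  let ?n = "dim_col G"
  have n: "dim_col H = ?n" and rk: "mat_rank G + mat_rank H = ?n" using GH by (auto simp: orth_dual_def)
  have orth: "(\<Sum>e<?n. H $$ (j, e) * G $$ (i, e)) = 0" if "i < dim_row G" "j < dim_row H" for i j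
  proof -
    have "row G i \<bullet> row H j = 0" using GH that by (auto simp: orth_dual_def)
    then show ?thesis using that n by (simp add: scalar_prod_def lessThan_atLeast0 mult.commute)
  qed
  show "{..<?n} - I \<subseteq> {..<dim_col H}" using n by auto
  fix c f
  assume c: "\<forall>i<dim_row H. (\<Sum>e\<in>{..<?n} - I. H $$ (i, e) * c e) = 0" and f: "f \<in> {..<?n} - I"
  show "c f = 0"
  proof (rule ccontr)
    assume cf: "c f \<noteq> 0"
    have finI: "finite I" and IE: "I \<subseteq> {..<?n}"
      using cols_indep_finite[OF I(1)] cols_indep_subset[OF I(1)] by auto
    obtain y where y: "dual_system G I y" using dual_system_exists[OF I(1)] by metis
    obtain J where J: "cols_indep H J" "J \<subseteq> {..<?n}" "card J = mat_rank H"
      using col_rank_attained[of H "{..<?n}"] by (auto simp: mat_rank_eq_col_rank n)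
    \<comment> \<open>\<open>None\<close> stands for the relation \<open>c\<close> extended by zero
      to \<open>I\<close>, \<open>Some i\<close> for the row combination of \<open>G\<close> dual to
      \<open>i\<close>.\<close>
    define w where "w z e = (case z of None \<Rightarrow> (if e \<in> I then 0 else c e)
        | Some i \<Rightarrow> (\<Sum>l<dim_row G. y i l * G $$ (l, e)))" for z e
    let ?Y = "insert None (Some ` I)"
    have "card ?Y = Suc (mat_rank G)" using finI I(2) by (simp add: card_image)
    moreover have "card ({..<?n} - J) = mat_rank G"
      using J rk cols_indep_finite[OF J(1)] by (simp add: card_Diff_subset)
    \<comment> \<open>There are \<open>mat_rank G + 1\<close> unknowns but only
      \<open>mat_rank G\<close> columns outside the basis \<open>J\<close> of
      \<open>H\<close>.\<close>
    ultimately obtain d where d: "\<exists>z\<in>?Y. d z \<noteq> 0" "\<forall>e\<in>{..<?n} - J. (\<Sum>z\<in>?Y. w z e * d z) = 0"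
      using underdetermined_system[of "{..<?n} - J" ?Y "\<lambda>e z. w z e"] finI by auto
    define u where "u e = (\<Sum>z\<in>?Y. w z e * d z)" for e
    have ue: "u e = w None e * d None + (\<Sum>i\<in>I. w (Some i) e * d (Some i))" for e
      using finI by (simp add: u_def sum.reindex)
    have Hw: "(\<Sum>e<?n. H $$ (j, e) * w z e) = 0" if "j < dim_row H" for z j
    proof (cases z)
      case None
      have "(\<Sum>e<?n. H $$ (j, e) * w z e) = (\<Sum>e\<in>{..<?n} - I. H $$ (j, e) * c e)"
        by (intro sum.mono_neutral_cong_right) (auto simp: w_def None)
      then show ?thesis using c that by simp
    next
      case (Some i)
      have "(\<Sum>e<?n. H $$ (j, e) * w z e) =
          (\<Sum>l<dim_row G. y i l * (\<Sum>e<?n. H $$ (j, e) * G $$ (l, e)))"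
        by (simp add: w_def Some sum_distrib_left, subst sum.swap) (simp add: mult.left_commute)
      then show ?thesis using orth that by simp
    qed
    have "(\<Sum>e\<in>J. H $$ (j, e) * u e) = 0" if "j < dim_row H" for j
    proof -
      have "(\<Sum>e\<in>J. H $$ (j, e) * u e) = (\<Sum>e<?n. H $$ (j, e) * u e)"
        using J(2) d(2) by (intro sum.mono_neutral_left) (auto simp: u_def)
      also have "\<dots> = (\<Sum>z\<in>?Y. (\<Sum>e<?n. H $$ (j, e) * w z e) * d z)"
        unfolding u_def sum_distrib_left sum_distrib_right
        by (subst sum.swap) (simp only: mult.assoc)
      finally show ?thesis using Hw[OF that] by simp
    qed
    from cols_indepD[OF J(1) this] have "u e = 0" if "e < ?n" for e
      using d(2) that by (cases "e \<in> J") (auto simp: u_def)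
    note u0 = this
    \<comment> \<open>On \<open>I\<close> the vector of \<open>None\<close> is zero and the others
      are dual, so \<open>u i\<close> is the coefficient of \<open>Some i\<close>.\<close>
    have dS: "d (Some i) = 0" if i: "i \<in> I" for i
    proof -
      have "u i = (\<Sum>k\<in>I. if k = i then d (Some k) else 0)"
        unfolding ue using y i by (auto simp: w_def dual_system_def intro!: sum.cong)
      then show ?thesis using u0[of i] i IE finI by auto
    qed
    then have "d None \<noteq> 0" using d(1) by auto
    moreover have "u f = c f * d None" unfolding ue using f by (simp add: dS w_def)
    ultimately show False using u0[of f] f cf by simp
  qed
qed

text \<open>A basis \<open>K\<close> of \<open>B\<close> is extended to a basis \<open>I\<close> of
  \<open>G\<close>. The columns outside both \<open>B\<close> and \<open>I\<close> are independent
  in \<open>H\<close>, and at most \<open>card I - card K\<close> elements of \<open>I\<close> lie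
  outside \<open>B\<close>.\<close>

lemma orth_dual_rank_ge:
  fixes G :: "'k::field mat"
  assumes GH: "orth_dual G H" and B: "B \<subseteq> {..<dim_col G}"
  shows "card ({..<dim_col G} - B) + col_rank G B \<le> col_rank H ({..<dim_col G} - B) + mat_rank G"
proof -
  let ?E = "{..<dim_col G}"
  obtain K where K: "cols_indep G K" "K \<subseteq> B" "card K = col_rank G B"
    using col_rank_attained by blast
  obtain I where I: "cols_indep G I" "K \<subseteq> I" "I \<subseteq> ?E" "card I = mat_rank G"
    using extend_to_basis[OF K(1), of ?E] K(2) B unfolding mat_rank_eq_col_rank by blast
  have finI: "finite I" using cols_indep_finite[OF I(1)] .
  have "cols_indep H (?E - B - I)"
    by (rule cols_indep_mono[OF orth_dual_basis_complement[OF GH I(1,4)]]) auto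
  then have le: "card (?E - B - I) \<le> col_rank H (?E - B)" by (rule card_le_col_rank) auto
  have "card (?E - B) = card (?E - B - I) + card ((?E - B) \<inter> I)"
    by (subst card_Un_disjoint[symmetric]) (auto intro!: arg_cong[of _ _ card])
  moreover have "card ((?E - B) \<inter> I) + card K \<le> card I"
    using finI K(2) I(2) finite_subset[OF I(2) finI]
    by (subst card_Un_disjoint[symmetric]) (auto intro!: card_mono)
  ultimately show ?thesis using le K(3) I(4) by linarith
qed

text \<open>The opposite inequality arises from exchanging \<open>G\<close> and \<open>H\<close> and
  complementing \<open>B\<close>, as the two ranks sum to the number of columns.\<close>

lemma orth_dual_rank:
  fixes G :: "'k::field mat"
  assumes GH: "orth_dual G H" and B: "B \<subseteq> {..<dim_col G}"
  shows "card ({..<dim_col G} - B) + col_rank G B = col_rank H ({..<dim_col G} - B) + mat_rank G"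
proof -
  let ?E = "{..<dim_col G}"
  have n: "dim_col H = dim_col G" and rk: "mat_rank G + mat_rank H = dim_col G"
    using GH by (auto simp: orth_dual_def)
  have "?E - (?E - B) = B" using B by auto
  with orth_dual_rank_ge[OF orth_dual_sym[OF GH], of "?E - B"] n
  have "card B + col_rank H (?E - B) \<le> col_rank G B + mat_rank H" by auto
  moreover have "card B + card (?E - B) = dim_col G"
    using B card_mono[of ?E B] by (simp add: card_Diff_subset finite_subset)
  ultimately show ?thesis using orth_dual_rank_ge[OF GH B] rk by linarith
qed

section \<open>Regular matrices\<close>

lemma bij_betw_pick:
  assumes "finite I"
  shows "bij_betw (pick I) {..<card I} I"
proof -
  have inj: "inj_on (pick I) {..<card I}"
    by (rule linorder_inj_onI') (use pick_mono_le in fastforce)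
  moreover have "pick I ` {..<card I} \<subseteq> I" using pick_in_set_le by auto
  ultimately show ?thesis
    using card_subset_eq[OF assms, of "pick I ` {..<card I}"] by (simp add: bij_betw_def card_image)
qed

text \<open>The rational dual system selects as many rows as columns. The square submatrix on them
  is nonsingular, so its determinant is 1 or -1, and its inverse, the determinant times the
  adjugate, has integer entries that serve as coefficients.\<close>

lemma totally_unimodular_dual_system:
  assumes tu: "totally_unimodular M" and J: "cols_indep (rat_mat M) J"
  shows "\<exists>y. dual_system M J y"
proof -
  obtain I w where I: "I \<subseteq> {..<dim_row M}" "card I = card J" "dual_system (rat_mat M) J w"
    and supp: "\<And>j i. j \<in> J \<Longrightarrow> i \<notin> I \<Longrightarrow> w j i = 0"
    using dual_system_exists[OF J] by auto
  have finJ: "finite J" using J by (rule cols_indep_finite)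
  have finI: "finite I" using I(1) finite_subset by blast
  have JE: "J \<subseteq> {..<dim_col M}" using cols_indep_subset[OF J] by simp
  let ?k = "card J" and ?S = "submatrix M I J"
  have cI: "{i. i < dim_row M \<and> i \<in> I} = I" and cJ: "{i. i < dim_col M \<and> i \<in> J} = J"
    using I(1) JE by auto
  have S: "?S \<in> carrier_mat ?k ?k"
    using dim_submatrix[of M I J] I(2) by (intro carrier_matI) (simp_all add: cI cJ)
  have Sij: "?S $$ (a, b) = M $$ (pick I a, pick J b)" if "a < ?k" "b < ?k" for a b
    using submatrix_index[of a M I b J] that I(2) by (simp add: cI cJ)
  have bI: "bij_betw (pick I) {..<?k} I" and bJ: "bij_betw (pick J) {..<?k} J"
    using bij_betw_pick[OF finI] bij_betw_pick[OF finJ] I(2) by auto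
  have JM: "j < dim_col M" if "j \<in> J" for j using that JE by auto
  have IM: "i < dim_row M" if "i \<in> I" for i using that I by auto
  have detnz: "det ?S \<noteq> 0"
  proof
    assume "det ?S = 0"
    then obtain v where v: "v \<in> carrier_vec ?k" "v \<noteq> 0\<^sub>v ?k" "?S *\<^sub>v v = 0\<^sub>v ?k"
      using det_0_iff_vec_prod_zero[OF S] by auto
    \<comment> \<open>A kernel vector of the submatrix, read as coefficients on the columns in
      \<open>J\<close>. It is annihilated by the rows in \<open>I\<close>, so the dual system
      supported there forces it to be zero.\<close>
    define c where "c j = rat_of_int (v $ the_inv_into {..<?k} (pick J) j)" for j
    have c: "c (pick J b) = rat_of_int (v $ b)" if "b < ?k" for b
      using that bJ by (simp add: c_def the_inv_into_f_f bij_betw_def)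
    have zero: "(\<Sum>j\<in>J. rat_mat M $$ (i, j) * c j) = 0" if "i \<in> I" for i
    proof -
      have "i \<in> pick I ` {..<?k}" using that bij_betw_imp_surj_on[OF bI] by simp
      then obtain a where a: "a < ?k" "i = pick I a" by auto
      have "(\<Sum>j\<in>J. rat_mat M $$ (i, j) * c j) = (\<Sum>b<?k. rat_mat M $$ (i, pick J b) * c (pick J b))"
        using sum.reindex_bij_betw[OF bJ, of "\<lambda>j. rat_mat M $$ (i, j) * c j"] by simp
      also have "\<dots> = (\<Sum>b<?k. rat_of_int (?S $$ (a, b) * v $ b))"
      proof (rule sum.cong[OF refl])
        fix b assume "b \<in> {..<?k}"
        then have b: "b < ?k" "pick J b \<in> J" using bJ by (auto simp: bij_betw_def)
        then show "rat_mat M $$ (i, pick J b) * c (pick J b) = rat_of_int (?S $$ (a, b) * v $ b)"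
          using a that IM[OF that] JM by (simp add: Sij c)
      qed
      also have "\<dots> = rat_of_int ((?S *\<^sub>v v) $ a)"
        using a S v(1) by (simp add: scalar_prod_def lessThan_atLeast0)
      finally show ?thesis using v(3) a by simp
    qed
    have "c j = 0" if "j \<in> J" for j
    proof -
      have "w j i * (\<Sum>k\<in>J. rat_mat M $$ (i, k) * c k) = 0" for i
        using zero supp[OF that, of i] by (cases "i \<in> I") auto
      then show ?thesis using dual_system_coeff[OF I(3) finJ that, of c] by simp
    qed
    then have "v $ b = 0" if "b < ?k" for b
      using c[OF that] bij_betwE[OF bJ] that by simp
    then show False using v by (metis carrier_vecD eq_vecI index_zero_vec)
  qed
  have "det ?S \<in> {-1, 0, 1}" using tu I(1,2) JE by (auto simp: totally_unimodular_def)
  then have det1: "det ?S * det ?S = 1" using detnz by auto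
  \<comment> \<open>\<open>p\<close> and \<open>q\<close> turn row and column indices of
    \<open>M\<close> into positions in the submatrix.\<close>
  define p where "p i = the_inv_into {..<?k} (pick I) i" for i
  define q where "q j = the_inv_into {..<?k} (pick J) j" for j
  define y where "y j i = (if i \<in> I then det ?S * adj_mat ?S $$ (q j, p i) else 0)" for j i
  have "dual_system M J y"
    unfolding dual_system_def
  proof (intro ballI)
    fix j l assume jl: "j \<in> J" "l \<in> J"
    then have "j \<in> pick J ` {..<?k}" "l \<in> pick J ` {..<?k}"
      using bij_betw_imp_surj_on[OF bJ] by simp_all
    then obtain a b where ab: "a < ?k" "j = pick J a" "b < ?k" "l = pick J b" by auto
    have qa: "q j = a" using ab bJ by (auto simp: q_def the_inv_into_f_f bij_betw_def)
    have pc: "p (pick I c) = c" if "c < ?k" for c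
      using that bI by (auto simp: p_def the_inv_into_f_f bij_betw_def)
    have "(\<Sum>i<dim_row M. y j i * M $$ (i, l)) = (\<Sum>i\<in>I. y j i * M $$ (i, l))"
      using I(1) by (intro sum.mono_neutral_right) (auto simp: y_def)
    also have "\<dots> = (\<Sum>c<?k. y j (pick I c) * M $$ (pick I c, l))"
      using sum.reindex_bij_betw[OF bI, of "\<lambda>i. y j i * M $$ (i, l)"] by simp
    also have "\<dots> = (\<Sum>c<?k. det ?S * (adj_mat ?S $$ (a, c) * ?S $$ (c, b)))"
    proof (rule sum.cong[OF refl])
      fix c assume "c \<in> {..<?k}"
      then have "c < ?k" "pick I c \<in> I" using bI by (auto simp: bij_betw_def)
      then show "y j (pick I c) * M $$ (pick I c, l) = det ?S * (adj_mat ?S $$ (a, c) * ?S $$ (c, b))"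
        using ab(1,3) by (simp add: y_def pc qa Sij ab(4))
    qed
    also have "\<dots> = det ?S * (adj_mat ?S * ?S) $$ (a, b)"
      using ab S adj_mat(1)[OF S]
      by (simp add: scalar_prod_def lessThan_atLeast0 sum_distrib_left)
    also have "\<dots> = (if l = j then 1 else 0)"
      using ab det1 adj_mat(3)[OF S] bJ by (auto simp: bij_betw_def dest: inj_onD)
    finally show "(\<Sum>i<dim_row M. y j i * M $$ (i, l)) = (if l = j then 1 else 0)" .
  qed
  then show ?thesis by blast
qed

section \<open>Cuts and vertex-edge matrices\<close>

definition adjacency :: "('v, 'e) pre_digraph \<Rightarrow> 'e set \<Rightarrow> ('v \<times> 'v) set" where
  "adjacency D S = {(u, v). \<exists>e\<in>S. (tail D e = u \<and> head D e = v) \<or> (head D e = u \<and> tail D e = v)}"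

text \<open>The signed incidence vector of the cut between \<open>C\<close> and its complement,
  equivalently the sum of the rows of the vertex-edge matrix over \<open>C\<close>.\<close>

definition cut_vector :: "('v, 'e) pre_digraph \<Rightarrow> 'v set \<Rightarrow> 'e \<Rightarrow> int" where
  "cut_vector D C e = (if head D e \<in> C then 1 else 0) - (if tail D e \<in> C then 1 else 0)"

text \<open>The set is a connected component of the graph with edges \<open>S\<close>, and an edge
  of \<open>S\<close> has both ends in it or neither.\<close>

lemma cut_component_eq_0:
  assumes "e \<in> S"
  shows "cut_vector D ((adjacency D S)\<^sup>* `` {u}) e = 0"
proof -
  have "(tail D e, head D e) \<in> adjacency D S" "(head D e, tail D e) \<in> adjacency D S"
    using assms by (auto simp: adjacency_def)
  then show ?thesis by (auto simp: cut_vector_def intro: rtrancl_into_rtrancl)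
qed

lemma vertex_edge_matrix_col:
  assumes "vertex_edge_matrix D M" "e < dim_col M"
  shows "(\<Sum>i<dim_row M. (if i \<in> C then 1 else 0) * M $$ (i, e)) = cut_vector D C e"
proof -
  interpret fin_digraph D using assms(1) by (simp add: vertex_edge_matrix_def)
  have "head D e < dim_row M" "tail D e < dim_row M"
    using assms head_in_verts[of e] tail_in_verts[of e] by (auto simp: vertex_edge_matrix_def)
  moreover have "(\<Sum>i<dim_row M. (if i \<in> C then 1 else 0) * M $$ (i, e)) =
      (\<Sum>i<dim_row M. (if i = head D e then if i \<in> C then 1 else 0 else 0)) -
      (\<Sum>i<dim_row M. (if i = tail D e then if i \<in> C then 1 else 0 else 0))"
    unfolding sum_subtractf[symmetric]
    using assms by (intro sum.cong) (auto simp: vertex_edge_matrix_def)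
  ultimately show ?thesis by (simp add: cut_vector_def)
qed

text \<open>The columns along a walk, each with the sign of its traversal, telescope to the end
  vertex minus the start vertex.\<close>

lemma walk_column_combination:
  assumes D: "vertex_edge_matrix D M" and S: "S \<subseteq> {..<dim_col M}"
    and uv: "(u, v) \<in> (adjacency D S)\<^sup>*"
  shows "\<exists>c :: nat \<Rightarrow> rat. \<forall>i<dim_row M. (\<Sum>e\<in>S. rat_mat M $$ (i, e) * c e) =
           (if v = i then 1 else 0) - (if u = i then 1 else 0)"
  using uv
proof (induction rule: rtrancl_induct)
  case base
  then show ?case by (intro exI[of _ "\<lambda>_. 0"]) simp
next
  case (step v w)
  have fin: "finite S" using S finite_subset by blast
  obtain c :: "nat \<Rightarrow> rat" where c: "\<forall>i<dim_row M. (\<Sum>e\<in>S. rat_mat M $$ (i, e) * c e) =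
      (if v = i then 1 else 0) - (if u = i then 1 else 0)"
    using step.IH by blast
  obtain f where f: "f \<in> S" "(tail D f = v \<and> head D f = w) \<or> (head D f = v \<and> tail D f = w)"
    using step.hyps(2) by (auto simp: adjacency_def)
  \<comment> \<open>The direction of traversal; for a loop either sign would do, its column being
    zero.\<close>
  define s :: rat where "s = (if tail D f = v \<and> head D f = w then 1 else - 1)"
  have "(\<Sum>e\<in>S. rat_mat M $$ (i, e) * (c e + (if e = f then s else 0))) =
      (if w = i then 1 else 0) - (if u = i then 1 else 0)" if i: "i < dim_row M" for i
  proof -
    have "(\<Sum>e\<in>S. rat_mat M $$ (i, e) * (c e + (if e = f then s else 0))) =
        (if v = i then 1 else 0) - (if u = i then 1 else 0) + rat_mat M $$ (i, f) * s"
      using c i f(1) fin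
      by (simp add: distrib_left sum.distrib if_distrib[of "(*) _"] cong: if_cong)
    moreover have "rat_mat M $$ (i, f) =
        (if head D f = i then 1 else 0) - (if tail D f = i then 1 else 0)"
      using D S f(1) i by (auto simp: vertex_edge_matrix_def)
    ultimately show ?thesis using f(2) by (auto simp: s_def)
  qed
  then show ?case by (intro exI[of _ "\<lambda>e. c e + (if e = f then s else 0)"]) simp
qed

text \<open>Removing \<open>j\<close> from an independent \<open>J\<close> separates the ends of
  \<open>j\<close>, since a path between them would express its column through the others. The rows
  summed over the component of the head give a cut that meets \<open>J\<close> in \<open>j\<close>
  only.\<close>

lemma vertex_edge_matrix_dual_system:
  assumes D: "vertex_edge_matrix D M" and J: "cols_indep (rat_mat M) J"
  shows "\<exists>y. dual_system M J y"
proof -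
  have JE: "J \<subseteq> {..<dim_col M}" using cols_indep_subset[OF J] by simp
  have fin: "finite J" using cols_indep_finite[OF J] .
  define C where "C j = (adjacency D (J - {j}))\<^sup>* `` {head D j}" for j
  have tail_notin: "tail D j \<notin> C j" if j: "j \<in> J" for j
  proof
    assume "tail D j \<in> C j"
    then have "(head D j, tail D j) \<in> (adjacency D (J - {j}))\<^sup>*" by (simp add: C_def)
    from walk_column_combination[OF D _ this] JE
    obtain c :: "nat \<Rightarrow> rat" where c: "\<forall>i<dim_row M. (\<Sum>e\<in>J - {j}. rat_mat M $$ (i, e) * c e) =
        (if tail D j = i then 1 else 0) - (if head D j = i then 1 else 0)"
      by blast
    have "(\<Sum>e\<in>J. rat_mat M $$ (i, e) * (c(j := 1)) e) = 0" if i: "i < dim_row M" for i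
    proof -
      have "(\<Sum>e\<in>J. rat_mat M $$ (i, e) * (c(j := 1)) e) =
          rat_mat M $$ (i, j) + (\<Sum>e\<in>J - {j}. rat_mat M $$ (i, e) * c e)"
        using fin j by (simp add: sum.remove)
      moreover have "rat_mat M $$ (i, j) =
          (if head D j = i then 1 else 0) - (if tail D j = i then 1 else 0)"
        using D JE j i by (auto simp: vertex_edge_matrix_def)
      ultimately show ?thesis using c i by simp
    qed
    from cols_indepD[OF J _ j, of "c(j := 1)"] this show False by simp
  qed
  have "dual_system M J (\<lambda>j i. if i \<in> C j then 1 else 0)"
    unfolding dual_system_def
  proof (intro ballI)
    fix j k assume jk: "j \<in> J" "k \<in> J"
    have "cut_vector D (C j) k = (if k = j then 1 else 0)"
    proof (cases "k = j")
      case True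
      have "head D j \<in> C j" by (simp add: C_def)
      then show ?thesis using True tail_notin[OF jk(1)] by (simp add: cut_vector_def)
    next
      case False
      then show ?thesis using cut_component_eq_0[of k "J - {j}"] jk(2) by (simp add: C_def)
    qed
    then show "(\<Sum>i<dim_row M. (if i \<in> C j then 1 else 0) * M $$ (i, k)) = (if k = j then 1 else 0)"
      using vertex_edge_matrix_col[OF D] jk(2) JE by auto
  qed
  then show ?thesis by blast
qed

section \<open>Cycles and cycle-edge matrices\<close>

lemma both_ways_simps [simp]:
  "verts (both_ways D) = verts D" "arcs (both_ways D) = arcs D \<times> UNIV"
  "tail (both_ways D) (e, b) = (if b then tail D e else head D e)"
  "head (both_ways D) (e, b) = (if b then head D e else tail D e)"
  by (simp_all add: both_ways_def)

lemma sum_along_cas: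
  fixes g :: "'v \<Rightarrow> int"
  assumes "pre_digraph.cas G u p v"
  shows "(\<Sum>d\<leftarrow>p. g (head G d) - g (tail G d)) = g v - g u"
  using assms
  by (induction p arbitrary: u) (auto simp: pre_digraph.cas.simps)

text \<open>Each traversed edge contributes the change of the indicator of \<open>C\<close> along
  it, and these changes cancel around a closed walk. Distinctness of the edges makes each of them
  count once.\<close>

lemma cycle_orthogonal_cut:
  fixes n :: nat
  assumes D: "arcs D = {..<n}" and p: "graph_cycle D p"
  shows "(\<Sum>e<n. cycle_entry p e * cut_vector D C e) = 0"
proof -
  let ?g = "\<lambda>v. if v \<in> C then 1 else 0 :: int"
  obtain u where "pre_digraph.awalk (both_ways D) u p u"
    using p by (auto simp: graph_cycle_def pre_digraph.cycle_def)
  then have cas: "pre_digraph.cas (both_ways D) u p u" and sub: "set p \<subseteq> {..<n} \<times> UNIV"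
    by (auto simp: pre_digraph.awalk_def D)
  have dist: "distinct p" and inj: "inj_on fst (set p)"
    using p by (auto simp: graph_cycle_def distinct_map)
  have entry: "cycle_entry p (fst d) * cut_vector D C (fst d) =
      ?g (head (both_ways D) d) - ?g (tail (both_ways D) d)" if "d \<in> set p" for d
  proof (cases d)
    case (Pair e b)
    \<comment> \<open>\<open>cycle_entry\<close> looks for the forward traversal first, so it must
      be excluded before a backward one counts as -1.\<close>
    have "(e, True) \<notin> set p" if "\<not> b"
      using inj_onD[OF inj, of "(e, True)" d] \<open>d \<in> set p\<close> Pair that by auto
    then show ?thesis using that Pair by (auto simp: cycle_entry_def cut_vector_def)
  qed
  have off: "cycle_entry p e = 0" if "e \<notin> fst ` set p" for e
    using that by (force simp: cycle_entry_def)
  have "(\<Sum>e<n. cycle_entry p e * cut_vector D C e) = (\<Sum>e\<in>fst ` set p. cycle_entry p e * cut_vector D C e)"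
    using sub off by (intro sum.mono_neutral_right) auto
  also have "\<dots> = (\<Sum>d\<in>set p. ?g (head (both_ways D) d) - ?g (tail (both_ways D) d))"
    unfolding sum.reindex[OF inj] by (intro sum.cong) (auto simp: entry)
  also have "\<dots> = (\<Sum>d\<leftarrow>p. ?g (head (both_ways D) d) - ?g (tail (both_ways D) d))"
    using dist by (simp add: sum_list_distinct_conv_sum_set)
  also have "\<dots> = 0" using sum_along_cas[OF cas, of ?g] by simp
  finally show ?thesis .
qed

text \<open>Deleting the arcs outside \<open>S\<close>, but no vertices, records that the walk stays
  within \<open>S\<close>.\<close>

lemma adjacency_awalk:
  assumes D: "wf_digraph D" and S: "S \<subseteq> arcs D" and u: "u \<in> verts D"
    and uv: "(u, v) \<in> (adjacency D S)\<^sup>*"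
  shows "\<exists>p. pre_digraph.awalk (both_ways (D\<lparr>arcs := S\<rparr>)) u p v"
  using uv
proof (induction rule: rtrancl_induct)
  case base
  then show ?case using u by (intro exI[of _ "[]"]) (simp add: pre_digraph.awalk_def pre_digraph.cas.simps)
next
  case (step v w)
  interpret wf_digraph D by (rule D)
  let ?B = "both_ways (D\<lparr>arcs := S\<rparr>)"
  interpret B: wf_digraph ?B
    using S by unfold_locales auto
  obtain p where p: "B.awalk u p v" using step.IH by blast
  obtain d where d: "d \<in> arcs ?B" "tail ?B d = v" "head ?B d = w"
    using step.hyps(2) that[of "(_, True)"] that[of "(_, False)"] by (auto simp: adjacency_def)
  have "B.awalk v [d] w" using B.arc_implies_awalk[OF d(1)] d by simp
  then show ?case using B.awalk_appendI[OF p] by blast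
qed

text \<open>If an edge came back later, in either direction, the path would revisit the vertex from
  which that edge was first left.\<close>

lemma apath_distinct_edges:
  assumes "wf_digraph (both_ways D)" "pre_digraph.apath (both_ways D) u p v"
  shows "distinct (map fst p)"
  using assms(2)
proof (induction p arbitrary: u)
  case Nil
  then show ?case by simp
next
  case (Cons d p)
  interpret B: wf_digraph "both_ways D" by (rule assms(1))
  obtain e b where d: "d = (e, b)" by (cases d)
  from Cons.prems have p: "B.apath (head (both_ways D) d) p v" and u: "tail (both_ways D) d = u"
    and notin: "u \<notin> set (B.awalk_verts (head (both_ways D) d) p)"
    by (auto simp: B.apath_Cons_iff)
  have "e \<notin> fst ` set p"
  proof
    assume "e \<in> fst ` set p"
    then obtain c where c: "(e, c) \<in> set p" by auto
    then have ne: "p \<noteq> []" by auto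
    have cas: "B.cas (head (both_ways D) d) p v" using p by (auto simp: B.apath_def B.awalk_def)
    have "tail (both_ways D) (e, c) \<in> set (B.awalk_verts (head (both_ways D) d) p)"
      "head (both_ways D) (e, c) \<in> set (B.awalk_verts (head (both_ways D) d) p)"
      using c ne by (auto simp: B.set_awalk_verts_not_Nil_cas[OF cas ne] simp del: both_ways_simps)
    then show False using notin u d by (auto split: if_splits)
  qed
  then show ?case using Cons.IH[OF p] d by auto
qed

text \<open>Both functions depend on the endpoints of arcs only, so a walk found among fewer arcs
  can be read in the whole graph.\<close>

lemma awalk_both_ways_arcs_update:
  "pre_digraph.cas (both_ways (D\<lparr>arcs := S\<rparr>)) = pre_digraph.cas (both_ways D)"
  "pre_digraph.awalk_verts (both_ways (D\<lparr>arcs := S\<rparr>)) = pre_digraph.awalk_verts (both_ways D)"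
proof -
  have ends: "tail (both_ways (D\<lparr>arcs := S\<rparr>)) = tail (both_ways D)"
    "head (both_ways (D\<lparr>arcs := S\<rparr>)) = head (both_ways D)"
    by (auto simp: both_ways_def fun_eq_iff)
  have "pre_digraph.cas (both_ways (D\<lparr>arcs := S\<rparr>)) u p v = pre_digraph.cas (both_ways D) u p v" for u p v
    by (induction p arbitrary: u) (simp_all only: pre_digraph.cas.simps ends)
  moreover have "pre_digraph.awalk_verts (both_ways (D\<lparr>arcs := S\<rparr>)) u p = pre_digraph.awalk_verts (both_ways D) u p" for u p
    by (induction p arbitrary: u) (simp_all only: pre_digraph.awalk_verts.simps ends)
  ultimately show
    "pre_digraph.cas (both_ways (D\<lparr>arcs := S\<rparr>)) = pre_digraph.cas (both_ways D)"
    "pre_digraph.awalk_verts (both_ways (D\<lparr>arcs := S\<rparr>)) = pre_digraph.awalk_verts (both_ways D)"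
    by (auto simp: fun_eq_iff)
qed

text \<open>The edge \<open>j\<close> is followed by a simple path within \<open>S\<close> from its
  head back to its tail; the path cannot reuse \<open>j\<close>.\<close>

lemma cycle_through_edge:
  assumes D: "wf_digraph D" and S: "S \<subseteq> arcs D" and j: "j \<in> arcs D" "j \<notin> S"
    and conn: "(head D j, tail D j) \<in> (adjacency D S)\<^sup>*"
  obtains p where "graph_cycle D p" "(j, True) \<in> set p" "fst ` set p \<subseteq> insert j S"
proof -
  interpret wf_digraph D by (rule D)
  let ?B = "both_ways (D\<lparr>arcs := S\<rparr>)"
  interpret B: wf_digraph ?B
    using S by unfold_locales auto
  obtain q where "B.awalk (head D j) q (tail D j)"
    using adjacency_awalk[OF D S _ conn] j(1) by auto
  then obtain p where p: "B.apath (head D j) p (tail D j)"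
    using B.apath_awalk_to_apath by blast
  then have pS: "set p \<subseteq> S \<times> UNIV" by (auto simp: B.apath_def B.awalk_def)
  have dist: "distinct (map fst p)" using apath_distinct_edges[OF B.wf_digraph_axioms p] .
  have "pre_digraph.cycle (both_ways D) ((j, True) # p)"
    unfolding pre_digraph.cycle_def
  proof (intro exI conjI)
    show "pre_digraph.awalk (both_ways D) (tail D j) ((j, True) # p) (tail D j)"
      using p j(1) S by (auto simp: pre_digraph.awalk_def pre_digraph.cas.simps B.apath_def awalk_both_ways_arcs_update)
    show "distinct (tl (pre_digraph.awalk_verts (both_ways D) (tail D j) ((j, True) # p)))"
      using p by (simp add: pre_digraph.awalk_verts.simps B.apath_def awalk_both_ways_arcs_update)
  qed simp
  moreover have "j \<notin> fst ` set p" using pS j(2) by auto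
  ultimately have "graph_cycle D ((j, True) # p)" using dist by (simp add: graph_cycle_def)
  moreover have "fst ` set ((j, True) # p) \<subseteq> insert j S" using pS by auto
  ultimately show ?thesis using that by auto
qed

text \<open>The ends of \<open>j\<close> are connected outside \<open>J\<close>: otherwise the
  component of the head bounds a cut that lies within \<open>J\<close> and contains
  \<open>j\<close>, and its orthogonality to all cycles is a relation on \<open>J\<close>. Hence
  some cycle meets \<open>J\<close> in \<open>j\<close> only, and its row gives the
  functional.\<close>

lemma cycle_edge_matrix_dual_system:
  assumes D: "cycle_edge_matrix D M" and J: "cols_indep (rat_mat M) J"
  shows "\<exists>y. dual_system M J y"
proof -
  let ?n = "dim_col M"
  interpret fin_digraph D using D by (simp add: cycle_edge_matrix_def)
  have arcs: "arcs D = {..<?n}" using D by (simp add: cycle_edge_matrix_def)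
  have JE: "J \<subseteq> {..<?n}" using cols_indep_subset[OF J] by simp
  let ?S = "{..<?n} - J"
  have conn: "(head D j, tail D j) \<in> (adjacency D ?S)\<^sup>*" if j: "j \<in> J" for j
  proof (rule ccontr)
    assume neg: "\<not> ?thesis"
    define C where "C = (adjacency D ?S)\<^sup>* `` {head D j}"
    have "(\<Sum>e\<in>J. rat_mat M $$ (i, e) * rat_of_int (cut_vector D C e)) = 0" if "i < dim_row (rat_mat M)" for i
    proof -
      have i: "i < dim_row M" using that by simp
      obtain p where p: "graph_cycle D p" "\<forall>e<?n. M $$ (i, e) = cycle_entry p e"
        using D i by (auto simp: cycle_edge_matrix_def)
      have "(\<Sum>e\<in>J. rat_mat M $$ (i, e) * rat_of_int (cut_vector D C e)) =
          rat_of_int (\<Sum>e\<in>J. cycle_entry p e * cut_vector D C e)"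
        using i JE p(2) by (auto intro!: sum.cong)
      also have "(\<Sum>e\<in>J. cycle_entry p e * cut_vector D C e) = (\<Sum>e<?n. cycle_entry p e * cut_vector D C e)"
        using JE by (intro sum.mono_neutral_left) (auto simp: C_def cut_component_eq_0)
      finally show ?thesis using cycle_orthogonal_cut[OF arcs p(1)] by simp
    qed
    from cols_indepD[OF J this j] have "cut_vector D C j = 0" by simp
    moreover have "head D j \<in> C" "tail D j \<notin> C" using neg by (auto simp: C_def)
    ultimately show False by (simp add: cut_vector_def)
  qed
  have "\<exists>z. \<forall>k\<in>J. (\<Sum>i<dim_row M. z i * M $$ (i, k)) = (if k = j then 1 else 0)" if j: "j \<in> J" for j
  proof -
    obtain p where p: "graph_cycle D p" "(j, True) \<in> set p" "fst ` set p \<subseteq> insert j ?S"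
      using cycle_through_edge[OF wf_digraph _ _ _ conn[OF j]] arcs j JE by auto
    have entry: "cycle_entry p k = (if k = j then 1 else 0)" if "k \<in> J" for k
      using p(2,3) that by (force simp: cycle_entry_def)
    obtain i where i: "i < dim_row M" "(\<forall>e<?n. M $$ (i, e) = cycle_entry p e) \<or>
        (\<forall>e<?n. M $$ (i, e) = - cycle_entry p e)"
      using D p(1) by (auto simp: cycle_edge_matrix_def)
    \<comment> \<open>The row may record the cycle in the opposite direction; \<open>s\<close>
      corrects the sign.\<close>
    then obtain s where s: "\<forall>e<?n. s * M $$ (i, e) = cycle_entry p e"
      by (metis minus_minus mult_1 mult_minus1)
    have "(\<Sum>l<dim_row M. (if l = i then s else 0) * M $$ (l, k)) = (if k = j then 1 else 0)" if "k \<in> J" for k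
      using i(1) s JE that entry[OF that] by (auto simp: if_distrib[of "\<lambda>x. x * _"] cong: if_cong)
    then show ?thesis by (intro exI[of _ "\<lambda>l. if l = i then s else 0"]) simp
  qed
  then show ?thesis unfolding dual_system_def by metis
qed

lemma regular_matrix_dual_system:
  "regular_matrix M \<Longrightarrow> cols_indep (rat_mat M) J \<Longrightarrow> \<exists>y. dual_system M J y"
  unfolding regular_matrix_def
  using vertex_edge_matrix_dual_system cycle_edge_matrix_dual_system totally_unimodular_dual_system
  by blast

section \<open>Counting flows\<close>

text \<open>Over the field the column is a combination of the basis \<open>J\<close>. The dual
  system computes the coefficients by ring operations, so they lie in the image of
  \<open>hom\<close>, and injectivity carries the expansion back to the ring.\<close>

lemma column_expansion:
  fixes hom :: "'r::comm_ring_1 \<Rightarrow> 'k::field"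
  assumes hom: "inj_comm_ring_hom hom"
    and J: "cols_indep (map_mat hom M) J" "J \<subseteq> F" "F \<subseteq> {..<dim_col M}"
    and maxJ: "card J = col_rank (map_mat hom M) F"
    and y: "dual_system M J y" and f: "f \<in> F" and i: "i < dim_row M"
  shows "M $$ (i, f) = (\<Sum>j\<in>J. M $$ (i, j) * (\<Sum>l<dim_row M. y j l * M $$ (l, f)))"
proof -
  interpret inj_comm_ring_hom hom by (rule hom)
  have fin: "finite J" using cols_indep_finite[OF J(1)] .
  have "\<exists>x. \<forall>i<dim_row M. hom (M $$ (i, f)) = (\<Sum>j\<in>J. hom (M $$ (i, j)) * x j)"
  proof (cases "f \<in> J")
    case True
    then show ?thesis using fin
      by (intro exI[of _ "\<lambda>j. if j = f then 1 else 0"]) (simp add: if_distrib[of "(*) _"] cong: if_cong)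
  next
    case False
    have "\<not> cols_indep (map_mat hom M) (insert f J)"
    proof
      assume "cols_indep (map_mat hom M) (insert f J)"
      from card_le_col_rank[OF this, of F] maxJ fin False f J(2) show False by simp
    qed
    moreover have "f < dim_col M" using f J(3) by auto
    ultimately obtain x where x: "\<forall>i<dim_row M. map_mat hom M $$ (i, f) = (\<Sum>j\<in>J. map_mat hom M $$ (i, j) * x j)"
      using dependent_insert_column[OF J(1) _ False] by force
    have "hom (M $$ (i, f)) = (\<Sum>j\<in>J. hom (M $$ (i, j)) * x j)" if "i < dim_row M" for i
    proof -
      have "(\<Sum>j\<in>J. map_mat hom M $$ (i, j) * x j) = (\<Sum>j\<in>J. hom (M $$ (i, j)) * x j)"
        using that J(2,3) by (intro sum.cong) auto
      then show ?thesis using x that f J(3) by auto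
    qed
    then show ?thesis by blast
  qed
  then obtain x where x: "\<And>i. i < dim_row M \<Longrightarrow> hom (M $$ (i, f)) = (\<Sum>j\<in>J. hom (M $$ (i, j)) * x j)"
    by blast
  have coeff: "hom (\<Sum>l<dim_row M. y j l * M $$ (l, f)) = x j" if "j \<in> J" for j
  proof -
    have "hom (\<Sum>l<dim_row M. y j l * M $$ (l, f)) =
        (\<Sum>l<dim_row M. hom (y j l) * (\<Sum>k\<in>J. hom (M $$ (l, k)) * x k))"
      by (simp add: hom_sum hom_mult x)
    also have "\<dots> = (\<Sum>k\<in>J. hom (\<Sum>l<dim_row M. y j l * M $$ (l, k)) * x k)"
      by (simp add: hom_sum hom_mult sum_distrib_left sum_distrib_right mult.assoc)
         (rule sum.swap)
    also have "\<dots> = (\<Sum>k\<in>J. if k = j then x k else 0)"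
      using y that by (intro sum.cong) (auto simp: dual_system_def)
    finally show ?thesis using that fin by simp
  qed
  have "hom (M $$ (i, f)) = hom (\<Sum>j\<in>J. M $$ (i, j) * (\<Sum>l<dim_row M. y j l * M $$ (l, f)))"
    unfolding hom_sum[of _ J] hom_mult x[OF i] by (intro sum.cong) (auto simp: coeff)
  then show ?thesis by simp
qed

text \<open>Extensional functions make the set finite over a finite group and fit the extensional
  pairs of \<open>nowhere_zero_pairs\<close>.\<close>

definition flows_on ::
  "('r \<Rightarrow> 'a \<Rightarrow> 'a::ab_group_add) \<Rightarrow> 'r mat \<Rightarrow> nat set \<Rightarrow> (nat \<Rightarrow> 'a) set" where
  "flows_on act H F =
     {h \<in> {..<dim_col H} \<rightarrow>\<^sub>E UNIV. is_flow act H h \<and> (\<forall>e\<in>{..<dim_col H} - F. h e = 0)}"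

text \<open>The columns in \<open>F\<close> expand through \<open>J\<close> with ring coefficients,
  which act on the group: the values on \<open>F - J\<close> are free and determine those on
  \<open>J\<close>.\<close>

lemma card_flows_on:
  fixes hom :: "'r::comm_ring_1 \<Rightarrow> 'k::field" and act :: "'r \<Rightarrow> 'g::{ab_group_add, finite} \<Rightarrow> 'g"
  assumes hom: "inj_comm_ring_hom hom" and act: "Modules.module act" and F: "F \<subseteq> {..<dim_col H}"
    and dual: "\<And>J. cols_indep (map_mat hom H) J \<Longrightarrow> \<exists>y. dual_system H J y"
  shows "card (flows_on act H F) = CARD('g) ^ (card F - col_rank (map_mat hom H) F)"
proof -
  interpret act: Modules.module act by (rule act)
  let ?m = "dim_row H" and ?n = "dim_col H"
  obtain J where J: "cols_indep (map_mat hom H) J" "J \<subseteq> F" "card J = col_rank (map_mat hom H) F"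
    using col_rank_attained by blast
  obtain y where y: "dual_system H J y" using dual[OF J(1)] by blast
  have finF: "finite F" using finite_subset[OF F] by simp
  have finJ: "finite J" using cols_indep_finite[OF J(1)] .
  define a where "a f j = (\<Sum>l<?m. y j l * H $$ (l, f))" for f j
  have expand: "H $$ (i, f) = (\<Sum>j\<in>J. H $$ (i, j) * a f j)" if "f \<in> F" "i < ?m" for f i
    unfolding a_def by (rule column_expansion[OF hom J(1,2) F J(3) y that])
  have aJ: "a k j = (if k = j then 1 else 0)" if "j \<in> J" "k \<in> J" for j k
    using y that by (auto simp: a_def dual_system_def)
  have split: "(\<Sum>e\<in>F. g e) = (\<Sum>e\<in>J. g e) + (\<Sum>e\<in>F - J. g e)" for g :: "nat \<Rightarrow> 'g"
    using sum.subset_diff[OF J(2) finF, of g] by (simp add: add.commute)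
  have flow: "is_flow act H h \<longleftrightarrow> (\<forall>i<?m. (\<Sum>e\<in>F. act (H $$ (i, e)) (h e)) = 0)"
    if "\<forall>e\<in>{..<?n} - F. h e = 0" for h
  proof -
    have "(\<Sum>e<?n. act (H $$ (i, e)) (h e)) = (\<Sum>e\<in>F. act (H $$ (i, e)) (h e))" for i
      using F that by (intro sum.mono_neutral_right) auto
    then show ?thesis by (simp add: is_flow_def)
  qed
  have determined: "h j = - (\<Sum>f\<in>F - J. act (a f j) (h f))" if h: "h \<in> flows_on act H F" and j: "j \<in> J" for h j
  proof -
    have "\<forall>i<?m. (\<Sum>e\<in>F. act (H $$ (i, e)) (h e)) = 0"
      using h flow[of h] by (auto simp: flows_on_def)
    \<comment> \<open>Applying the functional of \<open>j\<close> to the flow equations isolates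
      \<open>h j\<close>.\<close>
    then have "0 = (\<Sum>l<?m. act (y j l) (\<Sum>e\<in>F. act (H $$ (l, e)) (h e)))" by simp
    also have "\<dots> = (\<Sum>e\<in>F. act (a e j) (h e))"
      by (simp add: act.scale_sum_right act.scale_sum_left a_def) (rule sum.swap)
    also have "\<dots> = (\<Sum>e\<in>J. if e = j then h e else 0) + (\<Sum>e\<in>F - J. act (a e j) (h e))"
      unfolding split using j by (intro arg_cong2[of _ _ _ _ "(+)"] sum.cong) (auto simp: aJ)
    finally show ?thesis using j finJ by (simp add: eq_neg_iff_add_eq_0)
  qed
  \<comment> \<open>The values on \<open>J\<close> are solved for; the default is zero at columns
    off \<open>F\<close> and \<open>undefined\<close> beyond the columns, as \<open>flows_on\<close>
    demands.\<close>
  define ext where "ext k e = (if e \<in> F - J then k e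
      else if e \<in> J then - (\<Sum>f\<in>F - J. act (a f e) (k f)) else if e < ?n then 0 else undefined)"
    for k :: "nat \<Rightarrow> 'g" and e
  have ext_flow: "ext k \<in> flows_on act H F" for k
  proof -
    have off: "\<forall>e\<in>{..<?n} - F. ext k e = 0" using J(2) by (auto simp: ext_def)
    have "(\<Sum>e\<in>F. act (H $$ (i, e)) (ext k e)) = 0" if i: "i < ?m" for i
    proof -
      have "(\<Sum>e\<in>J. act (H $$ (i, e)) (ext k e)) =
          (\<Sum>e\<in>J. - (\<Sum>f\<in>F - J. act (H $$ (i, e) * a f e) (k f)))"
        by (intro sum.cong) (auto simp: ext_def act.scale_sum_right)
      also have "\<dots> = - (\<Sum>f\<in>F - J. \<Sum>e\<in>J. act (H $$ (i, e) * a f e) (k f))"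
        by (simp add: sum_negf, rule sum.swap)
      also have "\<dots> = - (\<Sum>f\<in>F - J. act (H $$ (i, f)) (ext k f))"
        using expand i by (auto simp: act.scale_sum_left[symmetric] ext_def intro!: sum.cong)
      finally show ?thesis by (simp add: split)
    qed
    then have "is_flow act H (ext k)" using flow[OF off] by blast
    moreover have "ext k \<in> {..<?n} \<rightarrow>\<^sub>E UNIV" using F J(2) by (auto simp: ext_def PiE_iff extensional_def)
    ultimately show ?thesis using off by (simp add: flows_on_def)
  qed
  have "bij_betw (\<lambda>h. restrict h (F - J)) (flows_on act H F) ((F - J) \<rightarrow>\<^sub>E UNIV)"
  proof (rule bij_betw_byWitness[where f' = ext])
    show "\<forall>h\<in>flows_on act H F. ext (restrict h (F - J)) = h"
    proof (intro ballI ext)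
      fix h e assume h: "h \<in> flows_on act H F"
      consider "e \<in> F - J" | "e \<in> J" | "e < ?n" "e \<notin> F" | "\<not> e < ?n" using F J(2) by blast
      then show "ext (restrict h (F - J)) e = h e"
      proof cases
        case 2
        have "(\<Sum>f\<in>F - J. act (a f e) (restrict h (F - J) f)) = (\<Sum>f\<in>F - J. act (a f e) (h f))"
          by (intro sum.cong) auto
        then show ?thesis using 2 determined[OF h 2] by (simp add: ext_def)
      next
        case 3
        then show ?thesis using h J(2) by (auto simp: ext_def flows_on_def)
      next
        case 4
        then have "h e = undefined" using h PiE_arb[of h "{..<?n}" "\<lambda>_. UNIV"] by (simp add: flows_on_def)
        moreover have "e \<notin> F" "e \<notin> J" using 4 F J(2) by auto
        ultimately show ?thesis using 4 by (simp add: ext_def)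
      qed (simp add: ext_def)
    qed
    show "\<forall>k\<in>(F - J) \<rightarrow>\<^sub>E UNIV. restrict (ext k) (F - J) = k"
    proof
      fix k :: "nat \<Rightarrow> 'g" assume k: "k \<in> (F - J) \<rightarrow>\<^sub>E UNIV"
      have "restrict (ext k) (F - J) = restrict k (F - J)" by (rule restrict_ext) (simp add: ext_def)
      then show "restrict (ext k) (F - J) = k" using k by simp
    qed
  qed (use ext_flow in \<open>auto split: if_splits\<close>)
  then have "card (flows_on act H F) = card ((F - J) \<rightarrow>\<^sub>E (UNIV :: 'g set))"
    by (rule bij_betw_same_card)
  also have "\<dots> = CARD('g) ^ card (F - J)" using finF by (simp add: card_PiE)
  finally show ?thesis using J finJ by (simp add: card_Diff_subset)
qed

section \<open>The weighted sum\<close>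

lemma int_scale_diff:
  fixes x :: "'a::ab_group_add"
  shows "int_scale (int m - int n) x = (\<Sum>i<m. x) - (\<Sum>i<n. x)"
proof -
  have split: "(\<Sum>i<k. x) = (\<Sum>i<l. x) + (\<Sum>i<k - l. x)" if "l \<le> k" for k l :: nat
    using that by (induction k rule: dec_induct) (auto simp: Suc_diff_le add.assoc)
  show ?thesis
  proof (cases "n \<le> m")
    case True
    then have "nat (int m - int n) = m - n" by simp
    then show ?thesis using True split[OF True] by (simp add: int_scale_def)
  next
    case False
    then have "nat (- (int m - int n)) = n - m" "m \<le> n" by simp_all
    then show ?thesis using False split[of m n] by (simp add: int_scale_def)
  qed
qed

text \<open>Writing integers as differences of naturals turns the module laws into identities
  between repeated sums, without sign cases.\<close>

lemma module_int_scale: "Modules.module (int_scale :: int \<Rightarrow> 'a \<Rightarrow> 'a::ab_group_add)"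
proof
  have rep: "\<exists>m n. k = int m - int n" for k :: int
    by (metis diff_0 diff_zero int_cases2 of_nat_0)
  have add: "(\<Sum>i<m + n. x) = (\<Sum>i<m. x) + (\<Sum>i<n. x)" for m n :: nat and x :: 'a
    by (induction n) (auto simp: add.assoc)
  have mult: "(\<Sum>i<m * n. x) = (\<Sum>i<m. \<Sum>j<n. x)" for m n :: nat and x :: 'a
    by (induction m) (auto simp: add add.commute)
  fix k l :: int and x y :: 'a
  obtain a b where k: "k = int a - int b" using rep by blast
  obtain c d where l: "l = int c - int d" using rep by blast
  show "int_scale k (x + y) = int_scale k x + int_scale k y"
    unfolding k int_scale_diff by (simp add: sum.distrib)
  have "k + l = int (a + c) - int (b + d)" by (simp add: k l)
  then show "int_scale (k + l) x = int_scale k x + int_scale l x"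
    unfolding k l by (simp only: int_scale_diff add) simp
  have "k * l = int (a * c + b * d) - int (a * d + b * c)" by (simp add: k l algebra_simps)
  then have "int_scale (k * l) x = (\<Sum>i<a. \<Sum>j<c. x) + (\<Sum>i<b. \<Sum>j<d. x) -
      ((\<Sum>i<a. \<Sum>j<d. x) + (\<Sum>i<b. \<Sum>j<c. x))"
    by (simp only: int_scale_diff add mult)
  then show "int_scale k (int_scale l x) = int_scale (k * l) x"
    unfolding k l int_scale_diff by (simp add: sum_subtractf)
  show "int_scale 1 x = x" by (simp add: int_scale_def)
qed

lemma module_vector_scalar_mult:
  "Modules.module (vector_scalar_mult :: 'k::field \<Rightarrow> 'k ^ 'd \<Rightarrow> 'k ^ 'd)"
  by unfold_locales (simp_all add: Finite_Cartesian_Product.vec_eq_iff vector_scalar_mult_def algebra_simps)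

section \<open>Sums over flows\<close>

lemma is_flow_cong:
  assumes "\<And>e. e < dim_col H \<Longrightarrow> h e = h' e"
  shows "is_flow act H h = is_flow act H h'"
  using assms by (simp add: is_flow_def)

text \<open>Since \<open>\<omega> ^ \<sigma> = 1\<close>, the residue in the exponent may be
  replaced by the support size, and the classes merge into one sum. A pair is then recorded by its
  difference \<open>h\<close> and its first entry \<open>f\<close>.\<close>

lemma sum_power_nowhere_zero_pairs:
  fixes \<omega> :: complex and act :: "'r \<Rightarrow> 'g::{ab_group_add, finite} \<Rightarrow> 'g" and H :: "'r mat"
  assumes \<sigma>: "\<sigma> > 0" and \<omega>: "\<omega> ^ \<sigma> = 1"
  defines "n \<equiv> dim_col H" and "q \<equiv> of_nat CARD('g) :: complex"
  shows "(\<Sum>k<\<sigma>. \<omega> ^ k * of_nat (card (nowhere_zero_pairs act H k \<sigma>))) =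
         (\<Sum>h\<in>flows_on act H {..<n}. \<Prod>e<n. if h e = 0 then q - 1 else \<omega> * (q - 2))"
proof -
  let ?F = "{..<n} \<rightarrow>\<^sub>E (UNIV - {0 :: 'g})"
  define P where "P = {(f, g). f \<in> ?F \<and> g \<in> ?F \<and> is_flow act H (\<lambda>e. f e - g e)}"
  define s where "s = (\<lambda>(f, g). card (supp n (\<lambda>e. f e - g e :: 'g)))"
  let ?W = "flows_on act H {..<n}"
  \<comment> \<open>The admissible first entries: avoiding \<open>h e\<close> keeps the second entry
    \<open>f e - h e\<close> nonzero.\<close>
  define N where "N h = (\<Pi>\<^sub>E e\<in>{..<n}. {a. a \<noteq> 0 \<and> a \<noteq> h e})" for h :: "nat \<Rightarrow> 'g"
  have finN: "finite (N h)" for h unfolding N_def by (intro finite_PiE) auto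
  have finW: "finite ?W"
    by (rule finite_subset[of _ "{..<n} \<rightarrow>\<^sub>E UNIV"]) (auto simp: flows_on_def n_def intro: finite_PiE)
  have "finite ?F" by (intro finite_PiE) auto
  then have finP: "finite P" by (rule_tac finite_subset[of _ "?F \<times> ?F"]) (auto simp: P_def)
  have \<omega>_mod: "\<omega> ^ (m mod \<sigma>) = \<omega> ^ m" for m
    using \<omega> by (metis mult_1 mult_div_mod_eq power_add power_mult power_one)
  have "(\<Sum>k<\<sigma>. \<omega> ^ k * of_nat (card (nowhere_zero_pairs act H k \<sigma>))) =
      (\<Sum>k<\<sigma>. \<Sum>x\<in>{x \<in> P. s x mod \<sigma> = k}. \<omega> ^ s x)"
  proof (rule sum.cong[OF refl])
    fix k assume "k \<in> {..<\<sigma>}"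
    then have "nowhere_zero_pairs act H k \<sigma> = {x \<in> P. s x mod \<sigma> = k}"
      by (auto simp: nowhere_zero_pairs_def P_def s_def n_def)
    moreover have "(\<Sum>x\<in>{x \<in> P. s x mod \<sigma> = k}. \<omega> ^ s x) = (\<Sum>x\<in>{x \<in> P. s x mod \<sigma> = k}. \<omega> ^ k)"
      by (intro sum.cong) (auto simp: \<omega>_mod)
    ultimately show "\<omega> ^ k * of_nat (card (nowhere_zero_pairs act H k \<sigma>)) =
        (\<Sum>x\<in>{x \<in> P. s x mod \<sigma> = k}. \<omega> ^ s x)" by simp
  qed
  also have "\<dots> = (\<Sum>x\<in>P. \<omega> ^ s x)"
    using finP \<sigma> by (intro sum.group) auto
  also have "\<dots> = (\<Sum>(h, f)\<in>Sigma ?W N. \<omega> ^ card (supp n h))"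
  proof (rule sum.reindex_bij_witness[where
        i = "\<lambda>(h, f). (f, \<lambda>e\<in>{..<n}. f e - h e)" and j = "\<lambda>(f, g). (\<lambda>e\<in>{..<n}. f e - g e, f)"])
    fix x assume "x \<in> P"
    then obtain f g where x: "x = (f, g)" and f: "f \<in> ?F" and g: "g \<in> ?F"
      and flow: "is_flow act H (\<lambda>e. f e - g e)" by (auto simp: P_def)
    have "(\<lambda>e\<in>{..<n}. f e - (\<lambda>e\<in>{..<n}. f e - g e) e) = restrict g {..<n}"
      by (rule restrict_ext) simp
    then show "(case case x of (f, g) \<Rightarrow> (\<lambda>e\<in>{..<n}. f e - g e, f) of
        (h, f) \<Rightarrow> (f, \<lambda>e\<in>{..<n}. f e - h e)) = x"
      using g by (simp add: x PiE_restrict)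
    have "is_flow act H (\<lambda>e\<in>{..<n}. f e - g e)"
      using flow is_flow_cong[of H "\<lambda>e\<in>{..<n}. f e - g e" "\<lambda>e. f e - g e" act] by (simp add: n_def)
    then have "(\<lambda>e\<in>{..<n}. f e - g e) \<in> ?W" by (simp add: flows_on_def n_def)
    moreover have "f \<in> N (\<lambda>e\<in>{..<n}. f e - g e)"
      using f g by (auto simp: N_def PiE_iff)
    ultimately show "(case x of (f, g) \<Rightarrow> (\<lambda>e\<in>{..<n}. f e - g e, f)) \<in> Sigma ?W N"
      by (simp add: x)
    have "supp n (\<lambda>e\<in>{..<n}. f e - g e) = supp n (\<lambda>e. f e - g e)" by (auto simp: supp_def)
    then show "(case case x of (f, g) \<Rightarrow> (\<lambda>e\<in>{..<n}. f e - g e, f) of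
        (h, f) \<Rightarrow> \<omega> ^ card (supp n h)) = \<omega> ^ s x"
      by (simp add: x s_def)
  next
    fix x assume "x \<in> Sigma ?W N"
    then obtain h f where x: "x = (h, f)" and h: "h \<in> ?W" and f: "f \<in> N h" by auto
    have hE: "h \<in> {..<n} \<rightarrow>\<^sub>E UNIV" using h by (simp add: flows_on_def n_def)
    have "(\<lambda>e\<in>{..<n}. f e - (\<lambda>e\<in>{..<n}. f e - h e) e) = restrict h {..<n}"
      by (rule restrict_ext) simp
    then show "(case case x of (h, f) \<Rightarrow> (f, \<lambda>e\<in>{..<n}. f e - h e) of
        (f, g) \<Rightarrow> (\<lambda>e\<in>{..<n}. f e - g e, f)) = x"
      using hE by (simp add: x PiE_restrict)
    have "is_flow act H (\<lambda>e. f e - (\<lambda>e\<in>{..<n}. f e - h e) e) = is_flow act H h"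
      by (rule is_flow_cong) (simp add: n_def)
    moreover have "is_flow act H h" using h by (simp add: flows_on_def)
    moreover have "f \<in> ?F" using f by (auto simp: N_def PiE_iff)
    moreover have "(\<lambda>e\<in>{..<n}. f e - h e) \<in> ?F" using f by (auto simp: N_def PiE_iff)
    ultimately show "(case x of (h, f) \<Rightarrow> (f, \<lambda>e\<in>{..<n}. f e - h e)) \<in> P"
      by (simp add: x P_def)
  qed
  also have "\<dots> = (\<Sum>h\<in>?W. of_nat (card (N h)) * \<omega> ^ card (supp n h))"
    using finW finN by (subst sum.Sigma[symmetric]) auto
  also have "\<dots> = (\<Sum>h\<in>?W. \<Prod>e<n. if h e = 0 then q - 1 else \<omega> * (q - 2))"
  proof (rule sum.cong[OF refl])
    fix h :: "nat \<Rightarrow> 'g"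
    have two: "of_nat (card {a. a \<noteq> 0 \<and> a \<noteq> x}) = (if x = 0 then q - 1 else q - 2)" for x :: 'g
    proof -
      have "{a. a \<noteq> 0 \<and> a \<noteq> x} = UNIV - {0, x}" by auto
      \<comment> \<open>Keeps the subtraction of cardinalities from being truncated, so that it
        carries over to the complex numbers.\<close>
      moreover have "card {0, x} \<le> CARD('g)" by (rule card_mono) auto
      ultimately have "of_nat (card {a. a \<noteq> 0 \<and> a \<noteq> x}) = q - of_nat (card {0, x})"
        by (simp add: card_Diff_subset of_nat_diff q_def)
      then show ?thesis by simp
    qed
    have "\<omega> ^ card (supp n h) = (\<Prod>e<n. if h e \<noteq> 0 then \<omega> else 1)"
      unfolding supp_def by (subst prod.inter_filter[symmetric]) auto
    moreover have "of_nat (card (N h)) = (\<Prod>e<n. if h e = 0 then q - 1 else q - 2)"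
      by (simp add: N_def card_PiE two)
    ultimately have "of_nat (card (N h)) * \<omega> ^ card (supp n h) =
        (\<Prod>e<n. (if h e = 0 then q - 1 else q - 2) * (if h e \<noteq> 0 then \<omega> else 1))"
      by (simp only: prod.distrib)
    also have "\<dots> = (\<Prod>e<n. if h e = 0 then q - 1 else \<omega> * (q - 2))"
      by (rule prod.cong) auto
    finally show "of_nat (card (N h)) * \<omega> ^ card (supp n h) =
        (\<Prod>e<n. if h e = 0 then q - 1 else \<omega> * (q - 2))" .
  qed
  finally show ?thesis .
qed

text \<open>Each factor is \<open>b\<close> plus a term \<open>a - b\<close> present only where
  \<open>h\<close> vanishes; expanding over the set \<open>B\<close> of columns where that term is
  chosen leaves the flows vanishing on \<open>B\<close>.\<close>

lemma sum_flows_prod: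
  fixes a b :: complex and act :: "'r \<Rightarrow> 'g::{ab_group_add, finite} \<Rightarrow> 'g" and H :: "'r mat"
  defines "n \<equiv> dim_col H"
  shows "(\<Sum>h\<in>flows_on act H {..<n}. \<Prod>e<n. if h e = 0 then a else b) =
         (\<Sum>B\<in>Pow {..<n}. (a - b) ^ card B * b ^ card ({..<n} - B) *
            of_nat (card (flows_on act H ({..<n} - B))))"
proof -
  let ?W = "flows_on act H {..<n}"
  have finW: "finite ?W"
    by (rule finite_subset[of _ "{..<n} \<rightarrow>\<^sub>E UNIV"]) (auto simp: flows_on_def n_def intro: finite_PiE)
  have "(\<Sum>h\<in>?W. \<Prod>e<n. if h e = 0 then a else b) =
      (\<Sum>h\<in>?W. \<Prod>e<n. (if h e = 0 then a - b else 0) + b)"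
    by (intro sum.cong prod.cong) auto
  also have "\<dots> = (\<Sum>h\<in>?W. \<Sum>B\<in>Pow {..<n}. (\<Prod>e\<in>B. if h e = 0 then a - b else 0) * (\<Prod>e\<in>{..<n} - B. b))"
    by (simp add: prod_add)
  also have "\<dots> = (\<Sum>B\<in>Pow {..<n}. \<Sum>h\<in>?W. (\<Prod>e\<in>B. if h e = 0 then a - b else 0) * (\<Prod>e\<in>{..<n} - B. b))"
    by (rule sum.swap)
  also have "\<dots> = (\<Sum>B\<in>Pow {..<n}. (a - b) ^ card B * b ^ card ({..<n} - B) *
      of_nat (card (flows_on act H ({..<n} - B))))"
  proof (rule sum.cong[OF refl])
    fix B assume "B \<in> Pow {..<n}"
    then have B: "B \<subseteq> {..<n}" and finB: "finite B" using finite_subset by auto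
    have "flows_on act H ({..<n} - B) = {h \<in> ?W. \<forall>e\<in>B. h e = 0}"
      using B by (auto simp: flows_on_def n_def)
    moreover have "(\<Sum>h\<in>?W. (\<Prod>e\<in>B. if h e = 0 then a - b else 0) * (\<Prod>e\<in>{..<n} - B. b)) =
        (\<Sum>h\<in>?W. if \<forall>e\<in>B. h e = 0 then (a - b) ^ card B * b ^ card ({..<n} - B) else 0)"
      using finB by (intro sum.cong) (auto intro: prod_zero)
    ultimately show "(\<Sum>h\<in>?W. (\<Prod>e\<in>B. if h e = 0 then a - b else 0) * (\<Prod>e\<in>{..<n} - B. b)) =
        (a - b) ^ card B * b ^ card ({..<n} - B) * of_nat (card (flows_on act H ({..<n} - B)))"
      using finW by (simp add: sum.inter_filter[symmetric])
  qed
  finally show ?thesis .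
qed

section \<open>Passage to the rank polynomial\<close>

lemma rank_poly_summand:
  fixes b d q :: "'a::field"
  assumes "b \<noteq> 0" "d \<noteq> 0" "g \<le> r" "g \<le> c" "r \<le> n" "c \<le> n"
  shows "b ^ (n - r) * d ^ r * ((q * b / d) ^ (r - g) * (d / b) ^ (c - g)) = d ^ c * b ^ (n - c) * q ^ (r - g)"
proof -
  \<comment> \<open>By the bounds no subtraction is truncated: both exponents are
    \<open>n - g\<close> here and \<open>r + c - g\<close> for \<open>d\<close>.\<close>
  have b: "b ^ (n - r) * b ^ (r - g) = b ^ (n - c) * b ^ (c - g)"
    using assms(3-6) by (simp add: power_add[symmetric])
  have d: "d ^ r * d ^ (c - g) = d ^ c * d ^ (r - g)"
    using assms(3-6) by (simp add: power_add[symmetric] add.commute)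
  have "b ^ (n - r) * d ^ r * ((q * b / d) ^ (r - g) * (d / b) ^ (c - g)) =
      (b ^ (n - r) * b ^ (r - g)) * (d ^ r * d ^ (c - g)) * q ^ (r - g) / (d ^ (r - g) * b ^ (c - g))"
    by (simp add: power_mult_distrib power_divide)
  also have "\<dots> = d ^ c * b ^ (n - c) * q ^ (r - g)"
    unfolding b d using assms(1,2) by simp
  finally show ?thesis .
qed

text \<open>Vanishing means \<open>m - 1 = \<omega> * (m - 2)\<close>; as \<omega> has modulus 1,
  the integers \<open>m - 1\<close> and \<open>m - 2\<close> would have equal absolute value, hence
  \<open>2 * m = 3\<close>.\<close>

lemma root_of_unity_shift_nonzero:
  fixes \<omega> :: complex
  assumes "\<omega> ^ \<sigma> = 1" "\<sigma> > 0"
  shows "(1 - \<omega>) * of_nat m + 2 * \<omega> - 1 \<noteq> 0"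
proof
  assume "(1 - \<omega>) * of_nat m + 2 * \<omega> - 1 = 0"
  then have "of_nat m - 1 = \<omega> * (of_nat m - 2)" by (simp add: algebra_simps)
  then have "of_real (real m - 1) = \<omega> * of_real (real m - 2)" by simp
  then have "cmod (of_real (real m - 1)) = cmod \<omega> * cmod (of_real (real m - 2))"
    by (metis norm_mult)
  moreover have "cmod \<omega> = 1" using power_eq_1_iff[OF assms(1)] assms(2) by simp
  ultimately have "\<bar>real m - 1\<bar> = \<bar>real m - 2\<bar>" by (simp only: norm_of_real mult_1)
  then have "2 * m = 3" by linarith
  then show False by presburger
qed

text \<open>Serves both cases: \<open>hom\<close> embeds the entries of \<open>H\<close> into the
  field over which ranks are taken, while \<open>act\<close> lets the entries act on the
  group.\<close>

lemma nowhere_zero_pairs_rank_poly: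
  fixes \<omega> :: complex and G :: "'k::field mat" and H :: "'r::comm_ring_1 mat"
    and hom :: "'r \<Rightarrow> 'k" and act :: "'r \<Rightarrow> 'g::{ab_group_add, finite} \<Rightarrow> 'g"
  assumes \<sigma>: "\<sigma> > 0" and \<omega>: "\<omega> ^ \<sigma> = 1"
    and hom: "inj_comm_ring_hom hom" and act: "Modules.module act"
    and GH: "orth_dual G (map_mat hom H)"
    and dual: "\<And>J. cols_indep (map_mat hom H) J \<Longrightarrow> \<exists>y. dual_system H J y"
    and q2: "CARD('g) \<noteq> 2"
  defines "n \<equiv> dim_col G" and "r \<equiv> mat_rank G" and "q \<equiv> of_nat CARD('g) :: complex"
  shows "(\<Sum>k<\<sigma>. \<omega> ^ k * of_nat (card (nowhere_zero_pairs act H k \<sigma>))) =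
    \<omega> ^ (n - r) * (q - 2) ^ (n - r) * ((1 - \<omega>) * q + 2 * \<omega> - 1) ^ r *
    rank_poly (column_matroid G)
      (\<omega> * q * (q - 2) / ((1 - \<omega>) * q + 2 * \<omega> - 1))
      (((1 - \<omega>) * q + 2 * \<omega> - 1) / (\<omega> * (q - 2)))"
proof -
  have n: "dim_col H = n" using GH by (simp add: orth_dual_def n_def)
  define b where "b = \<omega> * (q - 2)"
  define d where "d = (1 - \<omega>) * q + 2 * \<omega> - 1"
  have ab: "q - 1 - b = d" by (simp add: b_def d_def algebra_simps)
  have "q \<noteq> 2" using q2 unfolding q_def by (metis of_nat_eq_iff of_nat_numeral)
  moreover have "\<omega> \<noteq> 0" using \<omega> \<sigma> by (auto simp: power_0_left)
  ultimately have b0: "b \<noteq> 0" by (simp add: b_def)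
  have d0: "d \<noteq> 0" unfolding d_def q_def by (rule root_of_unity_shift_nonzero[OF \<omega> \<sigma>])
  let ?E = "{..<n}"
  have r: "col_rank G ?E = r" by (simp add: mat_rank_eq_col_rank n_def r_def)
  have rank_le_card: "col_rank M B \<le> card B" if "finite B" for M :: "'k mat" and B
    using col_rank_attained[of M B] card_mono[OF that] by metis
  have flows: "of_nat (card (flows_on act H (?E - B))) = q ^ (r - col_rank G B)" if B: "B \<subseteq> ?E" for B
  proof -
    \<comment> \<open>Matroid duality: the nullity of the complement in \<open>H\<close> is the
      corank of \<open>B\<close> in \<open>G\<close>.\<close>
    have "card (?E - B) - col_rank (map_mat hom H) (?E - B) = r - col_rank G B"
      using orth_dual_rank[OF GH, of B] B by (simp add: n_def r_def)
    then show ?thesis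
      using card_flows_on[OF hom act _ dual, of "?E - B"] by (auto simp: n q_def)
  qed
  have "(\<Sum>k<\<sigma>. \<omega> ^ k * of_nat (card (nowhere_zero_pairs act H k \<sigma>))) =
      (\<Sum>B\<in>Pow ?E. (q - 1 - b) ^ card B * b ^ card (?E - B) * of_nat (card (flows_on act H (?E - B))))"
    using sum_power_nowhere_zero_pairs[OF \<sigma> \<omega>, where act = act and H = H]
      sum_flows_prod[where act = act and H = H and a = "q - 1" and b = b]
    unfolding n q_def[symmetric] b_def[symmetric] by simp
  also have "\<dots> = (\<Sum>B\<in>Pow ?E. b ^ (n - r) * d ^ r *
      ((q * b / d) ^ (r - col_rank G B) * (d / b) ^ (card B - col_rank G B)))"
  proof (rule sum.cong[OF refl])
    fix B assume "B \<in> Pow ?E"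
    then have B: "B \<subseteq> ?E" by simp
    have finB: "finite B" using B finite_subset by blast
    obtain I where "cols_indep G I" "I \<subseteq> B" "card I = col_rank G B" using col_rank_attained by blast
    then have "col_rank G B \<le> r" using card_le_col_rank[of G I ?E] B r by auto
    moreover have "card B \<le> n" using card_mono[OF _ B] by simp
    moreover have "r \<le> n" using rank_le_card[of ?E G] r by simp
    moreover have "card (?E - B) = n - card B" using B finB by (simp add: card_Diff_subset)
    ultimately show "(q - 1 - b) ^ card B * b ^ card (?E - B) * of_nat (card (flows_on act H (?E - B))) =
        b ^ (n - r) * d ^ r * ((q * b / d) ^ (r - col_rank G B) * (d / b) ^ (card B - col_rank G B))"
      using rank_poly_summand[OF b0 d0, of "col_rank G B" r "card B" n q] rank_le_card[OF finB, of G]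
      by (simp add: ab flows[OF B])
  qed
  also have "\<dots> = b ^ (n - r) * d ^ r * rank_poly (column_matroid G) (q * b / d) (d / b)"
  proof -
    have "fst (column_matroid G) = ?E" by (simp add: column_matroid_def n_def)
    then show ?thesis by (simp add: rank_poly_def r sum_distrib_left)
  qed
  also have "q * b = \<omega> * q * (q - 2)" by (simp add: b_def)
  finally show ?thesis by (simp add: b_def d_def power_mult_distrib)
qed

theorem theorem3p3:
  fixes \<sigma> :: nat and \<omega> :: complex
  assumes "\<sigma> > 0" and "primitive_root_of_unity \<sigma> \<omega>"
  shows
   "(\<forall>(G :: int mat) H.
       regular_matrix G \<longrightarrow> regular_dual G H \<longrightarrow> CARD('a::{ab_group_add,finite}) \<noteq> 2 \<longrightarrow>
       (let n = dim_col G;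
            r = mat_rank (rat_mat G);
            q = of_nat CARD('a) :: complex
        in (\<Sum>k<\<sigma>. \<omega> ^ k *
              of_nat (card (nowhere_zero_pairs (int_scale :: int \<Rightarrow> 'a \<Rightarrow> 'a) H k \<sigma>)))
           = \<omega> ^ (n - r) * (q - 2) ^ (n - r) * ((1 - \<omega>) * q + 2 * \<omega> - 1) ^ r *
             rank_poly (column_matroid (rat_mat G))
               (\<omega> * q * (q - 2) / ((1 - \<omega>) * q + 2 * \<omega> - 1))
               (((1 - \<omega>) * q + 2 * \<omega> - 1) / (\<omega> * (q - 2)))))
    \<and>
    (\<forall>(G :: 'k::{field,finite} mat) H.
       orth_dual G H \<longrightarrow> CARD('k ^ 'd) \<noteq> 2 \<longrightarrow>
       (let n = dim_col G;
            r = mat_rank G;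
            q = of_nat CARD('k ^ 'd) :: complex
        in (\<Sum>k<\<sigma>. \<omega> ^ k *
              of_nat (card (nowhere_zero_pairs
                (vector_scalar_mult :: 'k \<Rightarrow> 'k ^ 'd \<Rightarrow> 'k ^ 'd) H k \<sigma>)))
           = \<omega> ^ (n - r) * (q - 2) ^ (n - r) * ((1 - \<omega>) * q + 2 * \<omega> - 1) ^ r *
             rank_poly (column_matroid G)
               (\<omega> * q * (q - 2) / ((1 - \<omega>) * q + 2 * \<omega> - 1))
               (((1 - \<omega>) * q + 2 * \<omega> - 1) / (\<omega> * (q - 2)))))"
proof (intro conjI allI impI)
  have root: "\<omega> ^ \<sigma> = 1" using assms(2) by (simp add: primitive_root_of_unity_def)
  {
    fix G H :: "int mat"
    assume H: "regular_dual G H" and q2: "CARD('a::{ab_group_add,finite}) \<noteq> 2"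
    have hom: "inj_comm_ring_hom rat_of_int" by unfold_locales auto
    have "regular_matrix H" and GH: "orth_dual (rat_mat G) (rat_mat H)"
      using H by (auto simp: regular_dual_def)
    from regular_matrix_dual_system[OF this(1)]
      nowhere_zero_pairs_rank_poly[OF assms(1) root hom module_int_scale GH _ q2]
    show "let n = dim_col G;
            r = mat_rank (rat_mat G);
            q = of_nat CARD('a) :: complex
        in (\<Sum>k<\<sigma>. \<omega> ^ k *
              of_nat (card (nowhere_zero_pairs (int_scale :: int \<Rightarrow> 'a \<Rightarrow> 'a) H k \<sigma>)))
           = \<omega> ^ (n - r) * (q - 2) ^ (n - r) * ((1 - \<omega>) * q + 2 * \<omega> - 1) ^ r *
             rank_poly (column_matroid (rat_mat G))
               (\<omega> * q * (q - 2) / ((1 - \<omega>) * q + 2 * \<omega> - 1))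
               (((1 - \<omega>) * q + 2 * \<omega> - 1) / (\<omega> * (q - 2)))"
      unfolding Let_def by simp
  next
    fix G H :: "'k::{field,finite} mat"
    assume GH: "orth_dual G H" and q2: "CARD('k ^ 'd) \<noteq> 2"
    \<comment> \<open>The entries already lie in the field, so the identity is the embedding, and
      dual systems exist for every matrix.\<close>
    have hom: "inj_comm_ring_hom (\<lambda>x :: 'k. x)" by unfold_locales auto
    have id: "map_mat (\<lambda>x. x) H = H" by (intro eq_matI) auto
    have GH': "orth_dual G (map_mat (\<lambda>x. x) H)" using GH by (simp add: id)
    have dual: "\<exists>y. dual_system H J y" if "cols_indep (map_mat (\<lambda>x. x) H) J" for J
      using that unfolding id by (rule dual_system_exists) blast
    show "let n = dim_col G;
            r = mat_rank G;
            q = of_nat CARD('k ^ 'd) :: complex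
        in (\<Sum>k<\<sigma>. \<omega> ^ k *
              of_nat (card (nowhere_zero_pairs
                (vector_scalar_mult :: 'k \<Rightarrow> 'k ^ 'd \<Rightarrow> 'k ^ 'd) H k \<sigma>)))
           = \<omega> ^ (n - r) * (q - 2) ^ (n - r) * ((1 - \<omega>) * q + 2 * \<omega> - 1) ^ r *
             rank_poly (column_matroid G)
               (\<omega> * q * (q - 2) / ((1 - \<omega>) * q + 2 * \<omega> - 1))
               (((1 - \<omega>) * q + 2 * \<omega> - 1) / (\<omega> * (q - 2)))"
      unfolding Let_def
      by (rule nowhere_zero_pairs_rank_poly[OF assms(1) root hom module_vector_scalar_mult GH' dual q2])
  }
qed

end
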